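(* Let $d\geq 2$ be fixed. There is an algorithm which, given a reduced boolean matrix with $n$ columns defining a simplicial complex of dimension $d$, computes the list of flats of this complex in time $O(n^{3d+3})$.
   Context: A (finite) simplicial complex is a pair $(V,H)$ with $V$ finite nonempty and $H\subseteq 2^V$ containing all singletons and closed under subsets; the dimension of a face $I$ is $|I|-1$ and the dimension of the complex is the maximal dimension of a face. A boolean matrix with row set $R$ and column set $V$ is nonsingular if, after independently permuting rows and columns, it is square lower unitriangular; $X\subseteq V$ is $M$-independent if some submatrix $M[Y,X]$ ($Y\subseteq R$) is nonsingular. A boolean matrix $M$ defines the complex $(V,H)$ where $H$ is the set of $M$-independent subsets of columns. $M$ is reduced if its rows are pairwise distinct and nonzero. A flat of $(V,H)$ is a set $X\subseteq V$ such that $I\cup\{p\}\in H$ for all $I\in H$ with $I\subseteq X$ and all $p\in V\setminus X$. Time is measured as the number of elementary operations, with $d$ treated as a constant. *)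

theory Defs
  imports "HOL-Library.Landau_Symbols"
begin

section \<open>Simplicial complexes and boolean matrices\<close>

definition simplicial_complex :: "'v set \<Rightarrow> 'v set set \<Rightarrow> bool" where
  "simplicial_complex V H \<longleftrightarrow>
     finite V \<and> V \<noteq> {} \<and> H \<subseteq> Pow V \<and> (\<forall>v\<in>V. {v} \<in> H) \<and> (\<forall>I\<in>H. \<forall>J. J \<subseteq> I \<longrightarrow> J \<in> H)"

text \<open>Integer-valued, since the empty face has dimension \<open>-1\<close>.\<close>

definition dimension :: "'v set set \<Rightarrow> int" where
  "dimension H = Max ((\<lambda>I. int (card I) - 1) ` H)"

definition flats :: "'v set \<Rightarrow> 'v set set \<Rightarrow> 'v set set" where
  "flats V H = {X. X \<subseteq> V \<and> (\<forall>I\<in>H. I \<subseteq> X \<longrightarrow> (\<forall>p\<in>V - X. insert p I \<in> H))}"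

text \<open>
  A boolean matrix with row set \<open>R\<close> and column set \<open>V\<close> is a map \<open>M\<close>, of which only the
  values on \<open>R \<times> V\<close> matter. The bijections \<open>r\<close> and \<open>c\<close> below list the rows and the columns of
  the submatrix \<open>M[Y,X]\<close> in the permuted order in which it is square (of size \<open>k\<close>) and lower
  unitriangular.
\<close>

definition nonsingular :: "('r \<Rightarrow> 'v \<Rightarrow> bool) \<Rightarrow> 'r set \<Rightarrow> 'v set \<Rightarrow> bool" where
  "nonsingular M Y X \<longleftrightarrow>
     (\<exists>k r c. bij_betw r {..<k::nat} Y \<and> bij_betw c {..<k} X \<and>
        (\<forall>i<k. M (r i) (c i)) \<and> (\<forall>i<k. \<forall>j<k. i < j \<longrightarrow> \<not> M (r i) (c j)))"

definition independent :: "'r set \<Rightarrow> 'v set \<Rightarrow> ('r \<Rightarrow> 'v \<Rightarrow> bool) \<Rightarrow> 'v set \<Rightarrow> bool" where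
  "independent R V M X \<longleftrightarrow> X \<subseteq> V \<and> (\<exists>Y\<subseteq>R. nonsingular M Y X)"

definition faces :: "'r set \<Rightarrow> 'v set \<Rightarrow> ('r \<Rightarrow> 'v \<Rightarrow> bool) \<Rightarrow> 'v set set" where
  "faces R V M = {X. independent R V M X}"

definition reduced :: "'r set \<Rightarrow> 'v set \<Rightarrow> ('r \<Rightarrow> 'v \<Rightarrow> bool) \<Rightarrow> bool" where
  "reduced R V M \<longleftrightarrow>
     (\<forall>i\<in>R. \<exists>v\<in>V. M i v) \<and> (\<forall>i\<in>R. \<forall>j\<in>R. i \<noteq> j \<longrightarrow> (\<exists>v\<in>V. M i v \<noteq> M j v))"


section \<open>Programs and the number of elementary operations\<close>

text \<open>
  The model of computation is a random access machine whose memory is organised as arrays of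
  natural numbers, programmed with structured control flow. A store maps an array name and a
  list of indices to the content of that cell; a scalar variable \<open>x\<close> is the array \<open>x\<close> at the
  empty index list. The index variables of an array access are listed in the program text, so
  their number does not depend on the input.

  The only arithmetic operation is the successor. Hence numbers grow by at most one per
  operation (see \<open>exec_bounded\<close>), and no work can be hidden in unit-cost operations on long
  numbers.
\<close>

type_synonym store = "nat \<Rightarrow> nat list \<Rightarrow> nat"

abbreviation var :: "store \<Rightarrow> nat \<Rightarrow> nat" where
  "var s x \<equiv> s x []"

definition upd :: "store \<Rightarrow> nat \<Rightarrow> nat list \<Rightarrow> nat \<Rightarrow> store" where
  "upd s a idx v = s(a := (s a)(idx := v))"

datatype test =
    Eq nat nat
  | Less nat nat

fun holds :: "test \<Rightarrow> store \<Rightarrow> bool" where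
  "holds (Eq x y) s \<longleftrightarrow> var s x = var s y"
| "holds (Less x y) s \<longleftrightarrow> var s x < var s y"

datatype com =
    Skip
  | Const nat nat
  | Inc nat
  | Load nat nat "nat list"
  | Store nat "nat list" nat
  | Seq com com
  | If test com com
  | While test com

text \<open>
  \<open>exec c s t s'\<close>: started in \<open>s\<close>, the program \<open>c\<close> halts in \<open>s'\<close> after \<open>t\<close> elementary operations.
  An array access is charged once more for every index.
\<close>

inductive exec :: "com \<Rightarrow> store \<Rightarrow> nat \<Rightarrow> store \<Rightarrow> bool" where
  Skip: "exec Skip s 1 s"
| Const: "exec (Const x k) s 1 (upd s x [] k)"
| Inc: "exec (Inc x) s 1 (upd s x [] (Suc (var s x)))"
| Load: "exec (Load x a ys) s (1 + length ys) (upd s x [] (s a (map (var s) ys)))"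
| Store: "exec (Store a ys x) s (1 + length ys) (upd s a (map (var s) ys) (var s x))"
| Seq: "exec c1 s t1 s1 \<Longrightarrow> exec c2 s1 t2 s2 \<Longrightarrow> exec (Seq c1 c2) s (t1 + t2) s2"
| IfTrue: "holds b s \<Longrightarrow> exec c1 s t s' \<Longrightarrow> exec (If b c1 c2) s (1 + t) s'"
| IfFalse: "\<not> holds b s \<Longrightarrow> exec c2 s t s' \<Longrightarrow> exec (If b c1 c2) s (1 + t) s'"
| WhileFalse: "\<not> holds b s \<Longrightarrow> exec (While b c) s 1 s"
| WhileTrue: "holds b s \<Longrightarrow> exec c s t1 s1 \<Longrightarrow> exec (While b c) s1 t2 s2 \<Longrightarrow>
    exec (While b c) s (1 + t1 + t2) s2"

inductive_cases exec_SkipE: "exec Skip s t s'"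
  and exec_ConstE: "exec (Const x k) s t s'"
  and exec_IncE: "exec (Inc x) s t s'"
  and exec_LoadE: "exec (Load x a ys) s t s'"
  and exec_StoreE: "exec (Store a ys x) s t s'"
  and exec_SeqE: "exec (Seq c1 c2) s t s'"
  and exec_IfE: "exec (If b c1 c2) s t s'"
  and exec_WhileE: "exec (While b c) s t s'"

lemma exec_deterministic:
  "exec c s t s' \<Longrightarrow> exec c s u s'' \<Longrightarrow> u = t \<and> s'' = s'"
proof (induction arbitrary: u s'' rule: exec.induct)
  case (Seq c1 s t1 s1 c2 t2 s2)
  from Seq.prems obtain u1 r1 u2 where
    "exec c1 s u1 r1" "exec c2 r1 u2 s''" "u = u1 + u2"
    by (auto elim: exec_SeqE)
  with Seq.IH(1)[of u1 r1] Seq.IH(2)[of u2 s''] show ?case by simp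
next
  case (IfTrue b s c1 t s' c2)
  from IfTrue.prems IfTrue.hyps(1) obtain u1 where "exec c1 s u1 s''" "u = 1 + u1"
    by (auto elim: exec_IfE)
  with IfTrue.IH[of u1 s''] show ?case by simp
next
  case (IfFalse b s c2 t s' c1)
  from IfFalse.prems IfFalse.hyps(1) obtain u1 where "exec c2 s u1 s''" "u = 1 + u1"
    by (auto elim: exec_IfE)
  with IfFalse.IH[of u1 s''] show ?case by simp
next
  case (WhileTrue b s c t1 s1 t2 s2)
  from WhileTrue.prems WhileTrue.hyps(1) obtain u1 r1 u2 where
    "exec c s u1 r1" "exec (While b c) r1 u2 s''" "u = 1 + u1 + u2"
    by (auto elim: exec_WhileE)
  with WhileTrue.IH(1)[of u1 r1] WhileTrue.IH(2)[of u2 s''] show ?case by simp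
next
  case (WhileFalse b s c)
  from WhileFalse.prems WhileFalse.hyps show ?case
    by (auto elim: exec_WhileE)
qed (auto elim: exec_SkipE exec_ConstE exec_IncE exec_LoadE exec_StoreE)

fun max_const :: "com \<Rightarrow> nat" where
  "max_const (Const x k) = k"
| "max_const (Seq c1 c2) = max (max_const c1) (max_const c2)"
| "max_const (If b c1 c2) = max (max_const c1) (max_const c2)"
| "max_const (While b c) = max_const c"
| "max_const _ = 0"

lemma exec_bounded:
  assumes "exec c s t s'" and "\<And>a idx. s a idx \<le> B" and "max_const c \<le> B"
  shows "s' a idx \<le> B + t"
  using assms
proof (induction arbitrary: a idx B rule: exec.induct)
  case (Seq c1 s t1 s1 c2 t2 s2)
  have "s1 a idx \<le> B + t1" for a idx
    using Seq.IH(1) Seq.prems by simp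
  then show ?case
    using Seq.IH(2)[of "B + t1"] Seq.prems by (simp add: add.assoc)
next
  case (WhileTrue b s c t1 s1 t2 s2)
  have "s1 a idx \<le> B + t1" for a idx
    using WhileTrue.IH(1) WhileTrue.prems by simp
  then have "s2 a idx \<le> B + t1 + t2"
    using WhileTrue.IH(2)[of "B + t1"] WhileTrue.prems by simp
  then show ?case by simp
next
  case (IfTrue b s c1 t s' c2)
  have "s' a idx \<le> B + t" using IfTrue.IH IfTrue.prems by simp
  then show ?case by simp
next
  case (IfFalse b s c2 t s' c1)
  have "s' a idx \<le> B + t" using IfFalse.IH IfFalse.prems by simp
  then show ?case by simp
qed (simp_all add: upd_def le_SucI trans_le_add1)

text \<open>
  Input: the number \<open>n\<close> of columns in variable \<open>0\<close>, the number \<open>m\<close> of rows in variable \<open>1\<close>, the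
  entries of the matrix in the two-dimensional array \<open>2\<close>; all other cells are \<open>0\<close>.
\<close>

definition input_store :: "nat \<Rightarrow> nat \<Rightarrow> (nat \<Rightarrow> nat \<Rightarrow> bool) \<Rightarrow> store" where
  "input_store n m M a idx =
     (if a = 0 \<and> idx = [] then n
      else if a = 1 \<and> idx = [] then m
      else if a = 2 \<and> length idx = 2 \<and> idx ! 0 < m \<and> idx ! 1 < n then of_bool (M (idx ! 0) (idx ! 1))
      else 0)"

text \<open>
  Output: the length of the list in variable \<open>3\<close>, and in row \<open>k\<close> of the two-dimensional array \<open>4\<close>
  the characteristic vector of its \<open>k\<close>-th member, a subset of \<open>{..<n}\<close>.
\<close>

definition output_list :: "nat \<Rightarrow> store \<Rightarrow> nat set list" where
  "output_list n s = map (\<lambda>k. {j. j < n \<and> s 4 [k, j] = 1}) [0..<var s 3]"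

end

theory Submission
  imports Defs
begin

text \<open>
  A flat \<open>X\<close> is recovered from any maximal face \<open>I \<subseteq> X\<close>, as \<open>I\<close> together with all \<open>p\<close> such that
  \<open>I \<union> {p}\<close> is not a face. Faces have at most \<open>d + 1\<close> elements, so it suffices to run through the
  \<open>(n + 1) ^ (d + 1)\<close> tuples over \<open>{0..n}\<close>, where \<open>n\<close> stands for an absent entry. For each tuple one
  decides whether it is a face that spans a flat and whether this flat is new. Both questions are
  bounded first-order formulas over the matrix and the output so far, and evaluating a formula costs
  a constant times the product of the ranges of nested quantifiers.

  A row is determined by a maximal face inside its zero set. Adding a column on which the row does
  not vanish gives a larger face, so that such faces have at most \<open>d\<close> elements and there are at most
  \<open>(n + 1) ^ d\<close> rows. Testing independence therefore costs \<open>O(n ^ d)\<close>, testing flatness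
  (\<open>d + 1\<close> quantifiers for a face and one for a column) and testing novelty (one quantifier over the
  list and one over the columns) cost \<open>O(n ^ (2 * d + 2))\<close>, and the loop over all tuples gives the
  exponent \<open>3 * d + 3\<close>.
\<close>

section \<open>Compiling bounded first-order formulas\<close>

text \<open>
  Variable \<open>5\<close> receives the truth value of a formula, variable \<open>6\<close> is scratch space for comparisons
  with \<open>1\<close>, and variable \<open>7\<close> will hold \<open>n + 1\<close>. \<open>FEx b v \<phi>\<close> lets \<open>v\<close> range over the numbers below the
  value of \<open>b\<close>.
\<close>

datatype fm =
    FBit nat nat nat
  | FEq nat nat
  | FNot fm
  | FAnd fm fm
  | FEx nat nat fm

fun eval :: "fm \<Rightarrow> store \<Rightarrow> bool" where
  "eval (FBit a x y) s \<longleftrightarrow> s a [var s x, var s y] = 1"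
| "eval (FEq x y) s \<longleftrightarrow> var s x = var s y"
| "eval (FNot \<phi>) s \<longleftrightarrow> \<not> eval \<phi> s"
| "eval (FAnd \<phi> \<psi>) s \<longleftrightarrow> eval \<phi> s \<and> eval \<psi> s"
| "eval (FEx b v \<phi>) s \<longleftrightarrow> (\<exists>i < var s b. eval \<phi> (upd s v [] i))"

text \<open>On a hit the search for a witness is left by loading the bound into the quantified
  variable, so that the guard fails while variable \<open>5\<close> still holds \<open>1\<close>.
  The initial \<open>Const 5 0\<close> is the answer for an empty range.\<close>

fun compile :: "fm \<Rightarrow> com" where
  "compile (FBit a x y) = Seq (Load 5 a [x, y]) (Seq (Const 6 1) (If (Eq 5 6) Skip (Const 5 0)))"
| "compile (FEq x y) = If (Eq x y) (Const 5 1) (Const 5 0)"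
| "compile (FNot \<phi>) = Seq (compile \<phi>) (Seq (Const 6 1) (If (Eq 5 6) (Const 5 0) (Const 5 1)))"
| "compile (FAnd \<phi> \<psi>) = Seq (compile \<phi>) (Seq (Const 6 1) (If (Eq 5 6) (compile \<psi>) Skip))"
| "compile (FEx b v \<phi>) = Seq (Const 5 0) (Seq (Const v 0) (While (Less v b)
     (Seq (compile \<phi>) (Seq (Const 6 1) (If (Eq 5 6) (Load v b []) (Inc v))))))"

definition readable :: "nat \<Rightarrow> nat \<Rightarrow> bool" where
  "readable k x \<longleftrightarrow> x < k \<and> x \<noteq> 5 \<and> x \<noteq> 6"

text \<open>
  Quantified variables are de Bruijn levels, so evaluating a formula well-formed at level \<open>k\<close> changes
  no variable below \<open>k\<close> except \<open>5\<close> and \<open>6\<close>.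
\<close>

fun wf_fm :: "nat \<Rightarrow> fm \<Rightarrow> bool" where
  "wf_fm k (FBit a x y) \<longleftrightarrow> a \<in> {2, 4} \<and> readable k x \<and> readable k y"
| "wf_fm k (FEq x y) \<longleftrightarrow> readable k x \<and> readable k y"
| "wf_fm k (FNot \<phi>) \<longleftrightarrow> wf_fm k \<phi>"
| "wf_fm k (FAnd \<phi> \<psi>) \<longleftrightarrow> wf_fm k \<phi> \<and> wf_fm k \<psi>"
| "wf_fm k (FEx b v \<phi>) \<longleftrightarrow> b \<in> {0, 1, 3, 7} \<and> v = k \<and> wf_fm (Suc k) \<phi>"

text \<open>For \<open>k\<close> at least \<open>8\<close> this covers all that a formula
  well-formed at level \<open>k\<close> can read: its free variables, the quantifier bounds, the
  matrix and the output array.\<close>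

definition agree :: "nat \<Rightarrow> store \<Rightarrow> store \<Rightarrow> bool" where
  "agree k s s' \<longleftrightarrow> (\<forall>x. readable k x \<longrightarrow> var s' x = var s x) \<and> s' 2 = s 2 \<and> s' 4 = s 4"

lemma agree_refl: "agree k s s"
  by (simp add: agree_def)

lemma agree_trans: "agree k s s' \<Longrightarrow> agree k s' s'' \<Longrightarrow> agree k s s''"
  by (simp add: agree_def)

lemma agree_mono: "agree k s s' \<Longrightarrow> j \<le> k \<Longrightarrow> agree j s s'"
  by (auto simp: agree_def readable_def)

lemma agree_upd: "8 \<le> k \<Longrightarrow> \<not> readable k x \<Longrightarrow> agree k s (upd s x [] i)"
  by (auto simp: agree_def upd_def readable_def)

lemma agree_upd_Suc: "agree k s s' \<Longrightarrow> agree (Suc k) (upd s k [] i) (upd s' k [] i)"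
  by (auto simp: agree_def upd_def readable_def)

text \<open>A quantifier at level \<open>k\<close> assigns the same value to variable
  \<open>k\<close> in both stores, so agreement passes from \<open>k\<close> to \<open>Suc k\<close>
  under the binder.\<close>

lemma eval_agree: "wf_fm k \<phi> \<Longrightarrow> 8 \<le> k \<Longrightarrow> agree k s s' \<Longrightarrow> eval \<phi> s' \<longleftrightarrow> eval \<phi> s"
proof (induction \<phi> arbitrary: k s s')
  case (FEx b v \<phi>)
  have "readable k b" using FEx.prems by (auto simp: readable_def)
  then have "var s' b = var s b" using FEx.prems by (simp add: agree_def)
  moreover have "eval \<phi> (upd s' v [] i) \<longleftrightarrow> eval \<phi> (upd s v [] i)" for i
    using FEx.prems agree_upd_Suc[of k s s' i] by (intro FEx.IH[of "Suc k"]) auto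
  ultimately show ?case by simp
next
  case (FAnd \<phi> \<psi>)
  then show ?case by (metis eval.simps(4) wf_fm.simps(4))
qed (auto simp: agree_def)

text \<open>If the range bounded by \<open>b\<close> has size at most \<open>N ^ e b\<close>,
  evaluation takes time \<open>O(N ^ degr e \<phi>)\<close>: nested ranges multiply, so exponents
  add, whereas conjuncts run one after the other, so the larger exponent counts.\<close>

fun degr :: "(nat \<Rightarrow> nat) \<Rightarrow> fm \<Rightarrow> nat" where
  "degr e (FBit a x y) = 0"
| "degr e (FEq x y) = 0"
| "degr e (FNot \<phi>) = degr e \<phi>"
| "degr e (FAnd \<phi> \<psi>) = max (degr e \<phi>) (degr e \<psi>)"
| "degr e (FEx b v \<phi>) = e b + degr e \<phi>"

text \<open>These are the constant factors in front of \<open>N ^ degr e \<phi>\<close>. The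
  \<open>8\<close> for a quantifier pays for an overhead of 4 in each round and of at most 4
  once.\<close>

fun cost :: "fm \<Rightarrow> nat" where
  "cost (FBit a x y) = 6"
| "cost (FEq x y) = 2"
| "cost (FNot \<phi>) = cost \<phi> + 3"
| "cost (FAnd \<phi> \<psi>) = cost \<phi> + cost \<psi> + 3"
| "cost (FEx b v \<phi>) = cost \<phi> + 8"

section \<open>Running time and correctness of compiled formulas\<close>

lemma exec_ConstI: "t = 1 \<Longrightarrow> s' = upd s x [] k \<Longrightarrow> exec (Const x k) s t s'"
  and exec_IncI: "t = 1 \<Longrightarrow> s' = upd s x [] (Suc (var s x)) \<Longrightarrow> exec (Inc x) s t s'"
  and exec_LoadI: "t = 1 + length ys \<Longrightarrow> s' = upd s x [] (s a (map (var s) ys)) \<Longrightarrow>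
    exec (Load x a ys) s t s'"
  and exec_StoreI: "t = 1 + length ys \<Longrightarrow> s' = upd s a (map (var s) ys) (var s x) \<Longrightarrow>
    exec (Store a ys x) s t s'"
  by (simp_all only: exec.Const exec.Inc exec.Load exec.Store)

lemma exec_IfI:
  assumes "holds b s \<Longrightarrow> exec c1 s t s'" and "\<not> holds b s \<Longrightarrow> exec c2 s t s'" and "u = Suc t"
  shows "exec (If b c1 c2) s u s'"
  using exec.IfTrue[of b s c1 t s' c2] exec.IfFalse[of b s c2 t s' c1] assms by auto

lemma exec_test:
  assumes "var s 5 = of_bool b"
    and "b \<Longrightarrow> exec c1 (upd s 6 [] 1) t s'" and "\<not> b \<Longrightarrow> exec c2 (upd s 6 [] 1) t s'"
    and "u = t + 2"
  shows "exec (Seq (Const 6 1) (If (Eq 5 6) c1 c2)) s u s'"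
proof -
  have h: "holds (Eq 5 6) (upd s 6 [] 1) \<longleftrightarrow> b" using assms(1) by (simp add: upd_def)
  have "exec (If (Eq 5 6) c1 c2) (upd s 6 [] 1) (1 + t) s'"
    using assms(2,3) h by (intro exec_IfI[where t = t]) (simp_all del: holds.simps)
  from exec.Seq[OF exec.Const this] show ?thesis using \<open>u = t + 2\<close> by (simp add: add.commute)
qed

text \<open>Induction on the number \<open>B - i\<close> of candidates left, with an arbitrary first
  candidate \<open>i\<close>. The behaviour of the body is assumed only for stores that agree with
  \<open>s0\<close>, because its time bound \<open>T\<close> depends on the values of the quantifier
  bounds; the loop preserves this agreement.\<close>

lemma compile_search:
  assumes wf: "wf_fm (Suc v) \<phi>" and v: "8 \<le> v" and b: "b \<in> {0, 1, 3, 7}"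
    and IH: "\<And>s. agree v s0 s \<Longrightarrow> \<exists>t s'. exec (compile \<phi>) s t s' \<and> t \<le> T \<and> agree (Suc v) s s' \<and>
      var s' 5 = of_bool (eval \<phi> s)"
    and "agree v s0 s" "var s v = i" "i \<le> B" "var s b = B" "var s 5 = 0"
  shows "\<exists>t s'. exec (While (Less v b)
     (Seq (compile \<phi>) (Seq (Const 6 1) (If (Eq 5 6) (Load v b []) (Inc v))))) s t s' \<and>
     t \<le> 2 + (B - i) * (T + 4) \<and> agree v s s' \<and>
     var s' 5 = of_bool (\<exists>j. i \<le> j \<and> j < B \<and> eval \<phi> (upd s v [] j))"
    (is "\<exists>t s'. exec ?W s t s' \<and> _")
  using assms(5-)
proof (induction "B - i" arbitrary: s i)
  case 0
  then have "exec ?W s 1 s" by (intro exec.WhileFalse) simp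
  then show ?case using 0 by (intro exI[of _ 1] exI[of _ s]) (auto simp: agree_refl)
next
  case (Suc r)
  have si: "upd s v [] i = s" using Suc.prems by (auto simp: upd_def fun_eq_iff)
  have lt: "holds (Less v b) s" using Suc.hyps(2) Suc.prems by simp
  from IH[OF Suc.prems(1)] obtain t1 s1 where
    1: "exec (compile \<phi>) s t1 s1" "t1 \<le> T" "agree (Suc v) s s1" "var s1 5 = of_bool (eval \<phi> s)"
    by blast
  have v56: "v \<noteq> 5" "v \<noteq> 6" "b \<noteq> 5" "b \<noteq> 6" "b \<noteq> v" "b < v" using v b by auto
  then have rd: "readable (Suc v) v" "readable (Suc v) b" by (simp_all add: readable_def)
  then have vb: "var s1 v = i" "var s1 b = B" using 1(3) Suc.prems by (simp_all add: agree_def)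
  have ag1: "agree v s s1" using agree_mono[OF 1(3)] by simp
  show ?case
  proof (cases "eval \<phi> s")
    case True
    \<comment> \<open>Setting \<open>v\<close> to \<open>B\<close> ends the loop at the first
      witness.\<close>
    define s2 where "s2 = upd (upd s1 6 [] 1) v [] B"
    have "exec (Seq (Const 6 1) (If (Eq 5 6) (Load v b []) (Inc v))) s1 3 s2"
      using 1(4) True v56 vb by (intro exec_test[where t = 1 and b = "eval \<phi> s"]) (auto intro!: exec_LoadI simp: s2_def upd_def)
    then have "exec (Seq (compile \<phi>) (Seq (Const 6 1) (If (Eq 5 6) (Load v b []) (Inc v)))) s
        (t1 + 3) s2"
      by (rule exec.Seq[OF 1(1)])
    moreover have "exec ?W s2 1 s2"
      using v56 vb by (intro exec.WhileFalse) (simp add: s2_def upd_def)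
    ultimately have "exec ?W s (1 + (t1 + 3) + 1) s2" using exec.WhileTrue lt by blast
    moreover have "1 + (t1 + 3) + 1 \<le> 2 + (B - i) * (T + 4)"
      using 1(2) Suc.hyps(2)[symmetric] by simp
    moreover have "agree v s s2"
      unfolding s2_def using v
      by (intro agree_trans[OF ag1] agree_trans[OF agree_upd agree_upd]) (auto simp: readable_def)
    moreover have "var s2 5 = of_bool (\<exists>j. i \<le> j \<and> j < B \<and> eval \<phi> (upd s v [] j))"
    proof -
      have "\<exists>j. i \<le> j \<and> j < B \<and> eval \<phi> (upd s v [] j)"
        using True si Suc.hyps(2) by (intro exI[of _ i]) simp
      then show ?thesis using True 1(4) v56 by (simp add: s2_def upd_def)
    qed
    ultimately show ?thesis by blast
  next
    case False
    define s2 where "s2 = upd (upd s1 6 [] 1) v [] (Suc i)"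
    have "exec (Seq (Const 6 1) (If (Eq 5 6) (Load v b []) (Inc v))) s1 3 s2"
      using 1(4) False v56 vb by (intro exec_test[where t = 1 and b = "eval \<phi> s"]) (auto intro!: exec_IncI simp: s2_def upd_def)
    then have body: "exec (Seq (compile \<phi>) (Seq (Const 6 1) (If (Eq 5 6) (Load v b []) (Inc v)))) s
        (t1 + 3) s2"
      by (rule exec.Seq[OF 1(1)])
    have ag2: "agree v s s2"
      unfolding s2_def using v
      by (intro agree_trans[OF ag1] agree_trans[OF agree_upd agree_upd]) (auto simp: readable_def)
    have "\<exists>t s'. exec ?W s2 t s' \<and> t \<le> 2 + (B - Suc i) * (T + 4) \<and> agree v s2 s' \<and>
     var s' 5 = of_bool (\<exists>j. Suc i \<le> j \<and> j < B \<and> eval \<phi> (upd s2 v [] j))"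
      using Suc.hyps(2) Suc.prems v56 vb 1(4) False
      by (intro Suc.hyps(1) agree_trans[OF Suc.prems(1) ag2]) (auto simp: s2_def upd_def)
    then obtain t3 s3 where 3: "exec ?W s2 t3 s3" "t3 \<le> 2 + (B - Suc i) * (T + 4)" "agree v s2 s3"
      "var s3 5 = of_bool (\<exists>j. Suc i \<le> j \<and> j < B \<and> eval \<phi> (upd s2 v [] j))" by blast
    \<comment> \<open>The first round may have changed variables from \<open>v\<close> upwards, but
      \<open>v\<close> is overwritten here and the higher ones are bound in \<open>\<phi>\<close>,
      so the remaining candidates are judged as in \<open>s\<close>.\<close>
    have ev: "eval \<phi> (upd s2 v [] j) \<longleftrightarrow> eval \<phi> (upd s v [] j)" for j
      using v by (intro eval_agree[OF wf _ agree_upd_Suc[OF ag2]]) simp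
    have "(\<exists>j. Suc i \<le> j \<and> j < B \<and> eval \<phi> (upd s v [] j)) \<longleftrightarrow>
        (\<exists>j. i \<le> j \<and> j < B \<and> eval \<phi> (upd s v [] j))"
      using False si by (metis Suc_leD Suc_leI le_neq_implies_less)
    then have "var s3 5 = of_bool (\<exists>j. i \<le> j \<and> j < B \<and> eval \<phi> (upd s v [] j))"
      using 3(4) ev by simp
    moreover have "exec ?W s (1 + (t1 + 3) + t3) s3" using exec.WhileTrue[OF lt body 3(1)] .
    moreover have "1 + (t1 + 3) + t3 \<le> 2 + (B - i) * (T + 4)"
    proof -
      have "B - i = Suc (B - Suc i)" using Suc.hyps(2) by simp
      then show ?thesis using 1(2) 3(2) by simp
    qed
    ultimately show ?thesis using agree_trans[OF ag2 3(3)] by blast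
  qed
qed

text \<open>All ranges are measured in powers of one base \<open>N\<close>, and
  \<open>1 \<le> N\<close> allows exponents to be raised to a common one. The bounds persist along
  the run, since the variables \<open>0\<close>, \<open>1\<close>, \<open>3\<close>,
  \<open>7\<close> are never overwritten by a compiled formula.\<close>

lemma compile_correct:
  assumes "wf_fm k \<phi>" "8 \<le> k" "1 \<le> N" "\<And>b. b \<in> {0, 1, 3, 7} \<Longrightarrow> var s b \<le> N ^ e b"
  shows "\<exists>t s'. exec (compile \<phi>) s t s' \<and> t \<le> cost \<phi> * N ^ degr e \<phi> \<and> agree k s s' \<and>
      var s' 5 = of_bool (eval \<phi> s)"
  using assms
proof (induction \<phi> arbitrary: k s)
  case (FBit a x y)
  have k: "8 \<le> k" by fact
  define s1 where "s1 = upd s 5 [] (s a [var s x, var s y])"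
  define s3 where "s3 = upd (upd s1 6 [] 1) 5 [] (of_bool (eval (FBit a x y) s))"
  have 1: "exec (Load 5 a [x, y]) s 3 s1" by (rule exec_LoadI) (simp_all add: s1_def)
  have 2: "exec (Const 6 1) s1 1 (upd s1 6 [] 1)" by (rule exec.Const)
  have 3: "exec (If (Eq 5 6) Skip (Const 5 0)) (upd s1 6 [] 1) 2 s3"
  proof (cases "eval (FBit a x y) s")
    case True
    then have "s3 = upd s1 6 [] 1" by (auto simp: s3_def s1_def upd_def fun_eq_iff)
    moreover have "holds (Eq 5 6) (upd s1 6 [] 1)" using True by (simp add: s1_def upd_def)
    ultimately show ?thesis
      using exec.IfTrue[OF _ exec.Skip, of "Eq 5 6" s3 "Const 5 0"] by (simp add: numeral_2_eq_2)
  next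
    case False
    then have "\<not> holds (Eq 5 6) (upd s1 6 [] 1)" by (simp add: s1_def upd_def)
    from exec.IfFalse[OF this exec.Const[of 5 0]] show ?thesis
      using False by (simp add: s3_def numeral_2_eq_2)
  qed
  have "exec (compile (FBit a x y)) s 6 s3" using exec.Seq[OF 1 exec.Seq[OF 2 3]] by simp
  moreover have "agree k s s3"
    unfolding s3_def s1_def using k
    by (intro agree_trans[OF agree_trans[OF agree_upd agree_upd] agree_upd]) (auto simp: readable_def)
  moreover have "var s3 5 = of_bool (eval (FBit a x y) s)" by (simp add: s3_def upd_def)
  ultimately show ?case by (intro exI[of _ 6] exI[of _ s3]) simp
next
  case (FEq x y)
  define s1 where "s1 = upd s 5 [] (of_bool (eval (FEq x y) s))"
  have "exec (compile (FEq x y)) s (1 + 1) s1"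
    using exec.Const[of 5 0 s] exec.Const[of 5 1 s]
    by (cases "eval (FEq x y) s") (auto simp: s1_def intro!: exec_IfI[where t = 1])
  moreover have "agree k s s1"
    unfolding s1_def using FEq.prems by (intro agree_upd) (auto simp: readable_def)
  moreover have "var s1 5 = of_bool (eval (FEq x y) s)" by (simp add: s1_def upd_def)
  ultimately show ?case by (intro exI[of _ "1 + 1"] exI[of _ s1]) simp
next
  case (FNot \<phi>)
  have "\<exists>t s'. exec (compile \<phi>) s t s' \<and> t \<le> cost \<phi> * N ^ degr e \<phi> \<and> agree k s s' \<and>
      var s' 5 = of_bool (eval \<phi> s)"
    using FNot.prems by (intro FNot.IH) auto
  then obtain t1 s1 where 1: "exec (compile \<phi>) s t1 s1" "t1 \<le> cost \<phi> * N ^ degr e \<phi>" "agree k s s1"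
    "var s1 5 = of_bool (eval \<phi> s)" by blast
  define s2 where "s2 = upd (upd s1 6 [] 1) 5 [] (of_bool (\<not> eval \<phi> s))"
  have "exec (Seq (Const 6 1) (If (Eq 5 6) (Const 5 0) (Const 5 1))) s1 3 s2"
    by (rule exec_test[where s = s1 and b = "eval \<phi> s" and t = 1, OF 1(4)]) (auto intro: exec_ConstI simp: s2_def)
  from exec.Seq[OF 1(1) this] have "exec (compile (FNot \<phi>)) s (t1 + 3) s2" by simp
  moreover have "agree k s s2"
    unfolding s2_def using FNot.prems
    by (intro agree_trans[OF 1(3)] agree_trans[OF agree_upd agree_upd]) (auto simp: readable_def)
  moreover have "t1 + 3 \<le> cost (FNot \<phi>) * N ^ degr e (FNot \<phi>)"
    using 1(2) FNot.prems(3) by (simp add: add_mult_distrib add_mono)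
  moreover have "var s2 5 = of_bool (eval (FNot \<phi>) s)" by (simp add: s2_def upd_def)
  ultimately show ?case by blast
next
  case (FAnd \<phi> \<psi>)
  have "\<exists>t s'. exec (compile \<phi>) s t s' \<and> t \<le> cost \<phi> * N ^ degr e \<phi> \<and> agree k s s' \<and>
      var s' 5 = of_bool (eval \<phi> s)"
    using FAnd.prems by (intro FAnd.IH) auto
  then obtain t1 s1 where 1: "exec (compile \<phi>) s t1 s1" "t1 \<le> cost \<phi> * N ^ degr e \<phi>" "agree k s s1"
    "var s1 5 = of_bool (eval \<phi> s)" by blast
  define s2 where "s2 = upd s1 6 [] 1"
  have ag2: "agree k s s2"
    unfolding s2_def using FAnd.prems
    by (intro agree_trans[OF 1(3)] agree_upd) (auto simp: readable_def)
  have "var s2 b \<le> N ^ e b" if "b \<in> {0, 1, 3, 7}" for b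
  proof -
    have "readable k b" using that FAnd.prems(2) by (auto simp: readable_def)
    then show ?thesis using ag2 FAnd.prems(4)[OF that] by (simp add: agree_def)
  qed
  then have "\<exists>t s'. exec (compile \<psi>) s2 t s' \<and> t \<le> cost \<psi> * N ^ degr e \<psi> \<and> agree k s2 s' \<and>
      var s' 5 = of_bool (eval \<psi> s2)"
    using FAnd.prems by (intro FAnd.IH) auto
  then obtain t3 s3 where 3: "exec (compile \<psi>) s2 t3 s3" "t3 \<le> cost \<psi> * N ^ degr e \<psi>" "agree k s2 s3"
    "var s3 5 = of_bool (eval \<psi> s2)" by blast
  have ev: "eval \<psi> s2 \<longleftrightarrow> eval \<psi> s" using FAnd.prems ag2 by (intro eval_agree) auto
  define s4 where "s4 = (if eval \<phi> s then s3 else s2)"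
  define t4 where "t4 = (if eval \<phi> s then t3 else 1)"
  have "exec (Seq (Const 6 1) (If (Eq 5 6) (compile \<psi>) Skip)) s1 (t4 + 2) s4"
    using 3(1) by (intro exec_test[where s = s1 and b = "eval \<phi> s" and t = t4, OF 1(4)]) (auto intro: exec.Skip simp: s2_def s4_def t4_def
      simp del: One_nat_def)
  from exec.Seq[OF 1(1) this] have "exec (compile (FAnd \<phi> \<psi>)) s (t1 + (t4 + 2)) s4" by simp
  moreover have "agree k s s4" using ag2 agree_trans[OF ag2 3(3)] by (simp add: s4_def)
  moreover have "var s4 5 = of_bool (eval (FAnd \<phi> \<psi>) s)"
    using 1(4) 3(4) ev by (auto simp: s4_def s2_def upd_def)
  moreover have "t1 + (t4 + 2) \<le> cost (FAnd \<phi> \<psi>) * N ^ degr e (FAnd \<phi> \<psi>)"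
  proof -
    define P where "P = N ^ degr e (FAnd \<phi> \<psi>)"
    have "N ^ degr e \<phi> \<le> P" "N ^ degr e \<psi> \<le> P"
      using FAnd.prems(3) by (auto simp: P_def intro: power_increasing)
    then have "cost \<phi> * N ^ degr e \<phi> \<le> cost \<phi> * P" "cost \<psi> * N ^ degr e \<psi> \<le> cost \<psi> * P"
      by (simp_all add: mult_left_mono)
    moreover have "1 \<le> P" using FAnd.prems(3) by (simp add: P_def)
    moreover have "t4 \<le> t3 + 1" by (simp add: t4_def)
    moreover have "cost (FAnd \<phi> \<psi>) * P = cost \<phi> * P + cost \<psi> * P + 3 * P"
      by (simp add: algebra_simps)
    ultimately show ?thesis using 1(2) 3(2) unfolding P_def[symmetric] by linarith
  qed
  ultimately show ?case by blast
next
  case (FEx b v \<phi>)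
  then have b: "b \<in> {0, 1, 3, 7}" and v: "v = k" and wf: "wf_fm (Suc v) \<phi>" by auto
  have v8: "8 \<le> v" using v FEx.prems(2) by simp
  define s1 where "s1 = upd (upd s 5 [] 0) v [] 0"
  define T where "T = cost \<phi> * N ^ degr e \<phi>"
  have ag1: "agree v s s1"
    unfolding s1_def using v8
    by (intro agree_trans[OF agree_upd agree_upd]) (auto simp: readable_def)
  have rd: "readable v c" if "c \<in> {0, 1, 3, 7}" for c
    using that v8 by (auto simp: readable_def)
  have IH: "\<exists>t s'. exec (compile \<phi>) r t s' \<and> t \<le> T \<and> agree (Suc v) r s' \<and>
      var s' 5 = of_bool (eval \<phi> r)" if "agree v s1 r" for r
  proof -
    have ag: "agree v s r" using ag1 that by (rule agree_trans)
    have "var r c \<le> N ^ e c" if "c \<in> {0, 1, 3, 7}" for c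
      using ag rd[OF that] FEx.prems(4)[OF that] by (simp add: agree_def)
    then show ?thesis unfolding T_def using FEx.prems(3) v8 by (intro FEx.IH[OF wf]) auto
  qed
  have "var s1 b = var s b" using ag1 rd[OF b] by (simp add: agree_def)
  have "\<exists>t s'. exec (While (Less v b)
     (Seq (compile \<phi>) (Seq (Const 6 1) (If (Eq 5 6) (Load v b []) (Inc v))))) s1 t s' \<and>
     t \<le> 2 + (var s b - 0) * (T + 4) \<and> agree v s1 s' \<and>
     var s' 5 = of_bool (\<exists>j. 0 \<le> j \<and> j < var s b \<and> eval \<phi> (upd s1 v [] j))"
    using v8 \<open>var s1 b = var s b\<close>
    by (intro compile_search[OF wf v8 b IH]) (auto simp: agree_refl s1_def upd_def)
  then obtain t2 s2 where 2: "exec (While (Less v b)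
     (Seq (compile \<phi>) (Seq (Const 6 1) (If (Eq 5 6) (Load v b []) (Inc v))))) s1 t2 s2"
     "t2 \<le> 2 + var s b * (T + 4)" "agree v s1 s2"
     "var s2 5 = of_bool (\<exists>j < var s b. eval \<phi> (upd s1 v [] j))" by auto
  have "exec (compile (FEx b v \<phi>)) s (1 + (1 + t2)) s2"
    unfolding compile.simps
    by (rule exec.Seq[OF exec.Const exec.Seq[OF exec.Const]]) (use 2(1) in \<open>simp add: s1_def\<close>)
  moreover have "agree k s s2" using agree_trans[OF ag1 2(3)] v by simp
  moreover have "eval \<phi> (upd s1 v [] j) \<longleftrightarrow> eval \<phi> (upd s v [] j)" for j
    using v8 by (intro eval_agree[OF wf _ agree_upd_Suc[OF ag1]]) simp
  moreover have "1 + (1 + t2) \<le> cost (FEx b v \<phi>) * N ^ degr e (FEx b v \<phi>)"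
  proof -
    have "1 \<le> N ^ degr e \<phi>" "1 \<le> N ^ e b" using FEx.prems(3) by simp_all
    \<comment> \<open>The loop overhead is linear in \<open>N ^ e b\<close> and is absorbed into the
      full power.\<close>
    then have ge: "1 \<le> N ^ e b * N ^ degr e \<phi>" "N ^ e b \<le> N ^ e b * N ^ degr e \<phi>"
      by (metis mult_le_mono nat_mult_1, simp)
    have "var s b * (T + 4) \<le> N ^ e b * (T + 4)"
      using FEx.prems(4)[OF b] by simp
    also have "\<dots> = cost \<phi> * (N ^ e b * N ^ degr e \<phi>) + 4 * N ^ e b"
      by (simp add: T_def algebra_simps)
    finally have "1 + (1 + t2) \<le> cost \<phi> * (N ^ e b * N ^ degr e \<phi>) + 4 * N ^ e b + 4"
      using 2(2) by linarith
    moreover have "cost (FEx b v \<phi>) * N ^ degr e (FEx b v \<phi>) =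
      cost \<phi> * (N ^ e b * N ^ degr e \<phi>) + 8 * (N ^ e b * N ^ degr e \<phi>)"
      by (simp add: power_add algebra_simps)
    ultimately show ?thesis using ge by linarith
  qed
  ultimately show ?case using 2(4) by (intro exI[of _ "1 + (1 + t2)"] exI[of _ s2]) simp
qed

section \<open>Faces, flats and the number of rows\<close>

fun chain :: "nat \<Rightarrow> (nat \<Rightarrow> nat \<Rightarrow> bool) \<Rightarrow> nat list \<Rightarrow> bool" where
  "chain m M [] \<longleftrightarrow> True"
| "chain m M (x # xs) \<longleftrightarrow> (\<exists>r<m. M r x \<and> (\<forall>y\<in>set xs. \<not> M r y)) \<and> chain m M xs"

lemma chain_nth:
  "chain m M xs \<longleftrightarrow> (\<forall>i<length xs. \<exists>r<m. M r (xs ! i) \<and> (\<forall>j<length xs. i < j \<longrightarrow> \<not> M r (xs ! j)))"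
proof (induction xs)
  case (Cons x xs)
  have "(\<forall>y\<in>set xs. P y) \<longleftrightarrow> (\<forall>j<length (x # xs). 0 < j \<longrightarrow> P ((x # xs) ! j))" for P
    by (auto simp: all_set_conv_all_nth less_Suc_eq_0_disj)
  moreover have "(\<forall>i<length (x # xs). P i) \<longleftrightarrow> P 0 \<and> (\<forall>i<length xs. P (Suc i))" for P
    by (auto simp: less_Suc_eq_0_disj)
  moreover have "(\<forall>j<length (x # xs). Suc i < j \<longrightarrow> P ((x # xs) ! j)) \<longleftrightarrow>
      (\<forall>j<length xs. i < j \<longrightarrow> P (xs ! j))" for P i
    by (auto simp: less_Suc_eq_0_disj)
  ultimately show ?case using Cons.IH by simp
qed simp

text \<open>The row that is 1 at the head vanishes on the tail, so the head cannot recur.\<close>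

lemma chain_distinct: "chain m M xs \<Longrightarrow> distinct xs"
  by (induction xs) auto

text \<open>A chain lists the columns in the order that makes the submatrix unitriangular: each
  column has a row with entry 1 there and 0 at all later columns. The rows can be chosen
  independently of each other, since their distinctness is automatic.\<close>

lemma faces_iff_chain:
  "X \<in> faces {..<m} {..<n} M \<longleftrightarrow> X \<subseteq> {..<n} \<and> (\<exists>xs. set xs = X \<and> chain m M xs)"
proof -
  have "(\<exists>Y\<subseteq>{..<m}. nonsingular M Y X) \<longleftrightarrow> (\<exists>xs. set xs = X \<and> chain m M xs)"
  proof
    assume "\<exists>Y\<subseteq>{..<m}. nonsingular M Y X"
    then obtain Y k r c where Y: "Y \<subseteq> {..<m}" and r: "bij_betw r {..<k::nat} Y"
      and c: "bij_betw c {..<k} X" and M: "\<forall>i<k. M (r i) (c i)"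
        "\<forall>i<k. \<forall>j<k. i < j \<longrightarrow> \<not> M (r i) (c j)"
      unfolding nonsingular_def by blast
    have "r i < m" if "i < k" for i using r Y that by (auto simp: bij_betw_def)
    then have "\<exists>r<m. M r (c i) \<and> (\<forall>j<k. i < j \<longrightarrow> \<not> M r (c j))" if "i < k" for i
      using M that by blast
    then have "chain m M (map c [0..<k])" by (simp add: chain_nth)
    moreover have "set (map c [0..<k]) = X" using c by (auto simp: bij_betw_def)
    ultimately show "\<exists>xs. set xs = X \<and> chain m M xs" by blast
  next
    assume "\<exists>xs. set xs = X \<and> chain m M xs"
    then obtain xs where xs: "set xs = X" "chain m M xs" by blast
    let ?k = "length xs"
    from xs(2) obtain r where r: "\<And>i. i < ?k \<Longrightarrow> r i < m \<and> M (r i) (xs ! i) \<and>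
        (\<forall>j<?k. i < j \<longrightarrow> \<not> M (r i) (xs ! j))"
      unfolding chain_nth by metis
    \<comment> \<open>If \<open>r i = r j\<close> with \<open>i < j\<close>, this row would be both
      0 and 1 in column \<open>xs ! j\<close>.\<close>
    have "inj_on r {..<?k}"
    proof (rule inj_onI)
      fix i j assume ij: "i \<in> {..<?k}" "j \<in> {..<?k}" "r i = r j"
      then show "i = j" using r[of i] r[of j] by (metis lessThan_iff linorder_neqE_nat)
    qed
    then have "bij_betw r {..<?k} (r ` {..<?k})" by (rule inj_on_imp_bij_betw)
    moreover have "bij_betw ((!) xs) {..<?k} X"
      using chain_distinct[OF xs(2)] xs(1) by (simp add: bij_betw_nth)
    ultimately have "nonsingular M (r ` {..<?k}) X"
      unfolding nonsingular_def using r by blast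
    moreover have "r ` {..<?k} \<subseteq> {..<m}" using r by auto
    ultimately show "\<exists>Y\<subseteq>{..<m}. nonsingular M Y X" by blast
  qed
  then show ?thesis by (simp add: faces_def independent_def)
qed

text \<open>The column \<open>v\<close> goes in front of a chain for \<open>I\<close>, with
  \<open>r\<close> as the row belonging to it.\<close>

lemma faces_insert:
  fixes M :: "nat \<Rightarrow> nat \<Rightarrow> bool"
  assumes "I \<in> faces {..<m} {..<n} M" "v < n" "r < m" "M r v" "\<forall>x\<in>I. \<not> M r x"
  shows "insert v I \<in> faces {..<m} {..<n} M"
proof -
  obtain xs where "set xs = I" "chain m M xs" using assms(1) faces_iff_chain by blast
  then have "set (v # xs) = insert v I \<and> chain m M (v # xs)" using assms by auto
  then show ?thesis using assms(1,2) faces_iff_chain by (metis insert_subset lessThan_iff)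
qed

text \<open>Subsets of \<open>{..<n}\<close> are represented by lists over \<open>{..n}\<close>, the entry \<open>n\<close> being void.\<close>

definition elems :: "nat \<Rightarrow> nat list \<Rightarrow> nat set" where
  "elems n l = {x \<in> set l. x < n}"

definition tuples :: "nat \<Rightarrow> nat \<Rightarrow> nat list set" where
  "tuples n k = {l. length l = k \<and> set l \<subseteq> {..n}}"

lemma card_tuples: "card (tuples n k) = Suc n ^ k"
  using card_lists_length_eq[of "{..n}" k] by (simp add: tuples_def conj_commute)

lemma finite_tuples: "finite (tuples n k)"
  using finite_lists_length_eq[of "{..n}" k] by (simp add: tuples_def conj_commute)

text \<open>List the set without repetition and pad with the void entry \<open>n\<close>.\<close>

lemma ex_tuple:
  assumes "S \<subseteq> {..<n}" "card S \<le> k"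
  shows "\<exists>l\<in>tuples n k. elems n l = S"
proof -
  obtain l where "set l = S" "length l = card S"
    using assms(1) finite_subset[of S] by (metis finite_lessThan finite_distinct_list distinct_card)
  then have "l @ replicate (k - card S) n \<in> tuples n k" "elems n (l @ replicate (k - card S) n) = S"
    using assms by (auto simp: tuples_def elems_def)
  then show ?thesis by blast
qed

text \<open>If \<open>I\<close> is a maximal face contained in a flat, then this flat is \<open>spanned V H I\<close>.\<close>

definition spanned :: "'v set \<Rightarrow> 'v set set \<Rightarrow> 'v set \<Rightarrow> 'v set" where
  "spanned V H I = {p \<in> V. p \<in> I \<or> insert p I \<notin> H}"

lemma maximal_face:
  assumes "simplicial_complex V H" "X \<subseteq> V"
  obtains I where "I \<in> H" "I \<subseteq> X" "\<And>p. p \<in> X - I \<Longrightarrow> insert p I \<notin> H"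
proof -
  have V: "finite V" "V \<noteq> {}" "H \<subseteq> Pow V" using assms(1) by (auto simp: simplicial_complex_def)
  then have "finite {I \<in> H. I \<subseteq> X}" using finite_subset[of H "Pow V"] by auto
  moreover have "{} \<in> {I \<in> H. I \<subseteq> X}"
    using assms(1) V(2) by (auto simp: simplicial_complex_def)
  then have "{I \<in> H. I \<subseteq> X} \<noteq> {}" by blast
  ultimately obtain I where I: "I \<in> H" "I \<subseteq> X" "\<forall>J\<in>{I \<in> H. I \<subseteq> X}. I \<subseteq> J \<longrightarrow> I = J"
    using finite_has_maximal[of "{I \<in> H. I \<subseteq> X}"] by blast
  have max: "insert p I \<notin> H" if p: "p \<in> X - I" for p
    using I p by blast
  show thesis using I(1,2) max by (rule that)
qed

text \<open>For \<open>p\<close> outside \<open>X\<close>, flatness makes \<open>insert p I\<close>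
  a face; for \<open>p\<close> in \<open>X - I\<close>, maximality of \<open>I\<close> forbids it.
  So membership in \<open>X\<close> can be read off from \<open>I\<close>.\<close>

lemma flat_spanned:
  assumes "simplicial_complex V H" "X \<in> flats V H"
  obtains I where "I \<in> H" "X = spanned V H I"
proof -
  have X: "X \<subseteq> V" using assms(2) by (simp add: flats_def)
  obtain I where I: "I \<in> H" "I \<subseteq> X" "\<And>p. p \<in> X - I \<Longrightarrow> insert p I \<notin> H"
    using maximal_face[OF assms(1) X] by blast
  have "insert p I \<in> H" if "p \<in> V - X" for p
    using assms(2) I that by (auto simp: flats_def)
  then have "X = spanned V H I" using I X by (auto simp: spanned_def)
  then show ?thesis using that I by blast
qed

section \<open>Cardinality of faces and the number of rows\<close>

lemma card_face_le:
  assumes "simplicial_complex V H" "dimension H = int d" "I \<in> H"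
  shows "card I \<le> Suc d"
proof -
  have "finite V" "H \<subseteq> Pow V" using assms(1) by (auto simp: simplicial_complex_def)
  then have "finite H" using finite_subset[of H "Pow V"] by auto
  then have "int (card I) - 1 \<le> dimension H" unfolding dimension_def using assms(3) by simp
  then show ?thesis using assms(2) by simp
qed

text \<open>Row \<open>i\<close> is sent to a tuple coding a maximal face inside its zero set
  \<open>?Z i\<close>. Two rows with the same tuple have equal zero sets, so they coincide in a
  reduced matrix, and the map into \<open>tuples n d\<close> is injective.\<close>

lemma card_rows_le:
  assumes red: "reduced {..<m} {..<n} M"
    and sc: "simplicial_complex {..<n} (faces {..<m} {..<n} M)"
    and dim: "dimension (faces {..<m} {..<n} M) = int d"
  shows "m \<le> Suc n ^ d"
proof -
  let ?H = "faces {..<m} {..<n} M" and ?Z = "\<lambda>i. {v. v < n \<and> \<not> M i v}"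
  \<comment> \<open>The last clause makes \<open>?Z i\<close> the least of the zero sets of rows
    that contain \<open>elems n l\<close>, so that \<open>l\<close> alone determines it.\<close>
  let ?Q = "\<lambda>i l. l \<in> tuples n d \<and> elems n l \<subseteq> ?Z i \<and>
      (\<forall>r<m. elems n l \<subseteq> ?Z r \<longrightarrow> ?Z i \<subseteq> ?Z r)"
  have "\<exists>l. ?Q i l" if i: "i < m" for i
  proof -
    have "?Z i \<subseteq> {..<n}" by auto
    then obtain I where I: "I \<in> ?H" "I \<subseteq> ?Z i" "\<And>p. p \<in> ?Z i - I \<Longrightarrow> insert p I \<notin> ?H"
      using maximal_face[OF sc] by blast
    \<comment> \<open>A nonzero entry of row \<open>i\<close> extends \<open>I\<close> by one column
      to a face, which lowers the bound on \<open>card I\<close> from \<open>Suc d\<close> to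
      \<open>d\<close>.\<close>
    obtain v where v: "v < n" "M i v" using red i unfolding reduced_def by blast
    have "insert v I \<in> ?H" using I(1,2) v i by (intro faces_insert[of _ _ _ _ _ i]) auto
    moreover have "v \<notin> I" "finite I" using v I(2) finite_subset[of I "{..<n}"] by auto
    ultimately have card: "card I \<le> d" using card_face_le[OF sc dim, of "insert v I"] by simp
    \<comment> \<open>A row \<open>r\<close> vanishing on \<open>I\<close> but not at some
      \<open>p\<close> in \<open>?Z i\<close> would make \<open>insert p I\<close> a face, against
      the maximality of \<open>I\<close>.\<close>
    have "?Z i \<subseteq> ?Z r" if "r < m" "I \<subseteq> ?Z r" for r
    proof
      fix p assume p: "p \<in> ?Z i"
      show "p \<in> ?Z r"
      proof (rule ccontr)
        assume "p \<notin> ?Z r"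
        then have "M r p" "p \<notin> I" using p that by auto
        then have "insert p I \<in> ?H"
          using I(1) p that by (intro faces_insert[of _ _ _ _ _ r]) auto
        then show False using I(3) p \<open>p \<notin> I\<close> by blast
      qed
    qed
    moreover obtain l where l: "l \<in> tuples n d" "elems n l = I"
      using ex_tuple[of I n d] I(2) card by blast
    ultimately have "?Q i l" using I(2) l by simp
    then show ?thesis ..
  qed
  then have "\<forall>i\<in>{..<m}. \<exists>l. ?Q i l" by blast
  from bchoice[OF this] obtain f where "\<forall>i\<in>{..<m}. ?Q i (f i)" by blast
  then have f: "f i \<in> tuples n d" "elems n (f i) \<subseteq> ?Z i"
    "r < m \<Longrightarrow> elems n (f i) \<subseteq> ?Z r \<Longrightarrow> ?Z i \<subseteq> ?Z r" if "i < m" for i r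
    using that by blast+
  have "inj_on f {..<m}"
  proof (rule inj_onI)
    fix i j assume ij: "i \<in> {..<m}" "j \<in> {..<m}" "f i = f j"
    then have "?Z i \<subseteq> ?Z j" "?Z j \<subseteq> ?Z i"
      using f(2)[of i] f(2)[of j] f(3)[of i j] f(3)[of j i] by simp_all
    then have "\<forall>v\<in>{..<n}. M i v = M j v" by blast
    then show "i = j" using red ij(1,2) unfolding reduced_def by metis
  qed
  moreover have "f ` {..<m} \<subseteq> tuples n d" using f(1) by blast
  ultimately have "card {..<m} \<le> card (tuples n d)"
    using finite_tuples by (rule card_inj_on_le)
  then show ?thesis by (simp add: card_tuples)
qed

section \<open>Formulas for independence, flatness and novelty\<close>

lemma readable_0: "8 \<le> k \<Longrightarrow> readable k 0"
  by (simp add: readable_def)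

definition Conj :: "fm list \<Rightarrow> fm" where
  "Conj \<phi>s = foldr FAnd \<phi>s (FEq 0 0)"

definition Disj :: "fm list \<Rightarrow> fm" where
  "Disj \<phi>s = FNot (Conj (map FNot \<phi>s))"

lemma eval_Conj [simp]: "eval (Conj \<phi>s) s \<longleftrightarrow> (\<forall>\<phi>\<in>set \<phi>s. eval \<phi> s)"
  by (induction \<phi>s) (auto simp: Conj_def)

lemma eval_Disj [simp]: "eval (Disj \<phi>s) s \<longleftrightarrow> (\<exists>\<phi>\<in>set \<phi>s. eval \<phi> s)"
  by (simp add: Disj_def)

lemma wf_Conj [simp]: "0 < k \<Longrightarrow> wf_fm k (Conj \<phi>s) \<longleftrightarrow> (\<forall>\<phi>\<in>set \<phi>s. wf_fm k \<phi>)"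
  by (induction \<phi>s) (auto simp: Conj_def readable_def)

lemma wf_Disj [simp]: "0 < k \<Longrightarrow> wf_fm k (Disj \<phi>s) \<longleftrightarrow> (\<forall>\<phi>\<in>set \<phi>s. wf_fm k \<phi>)"
  by (simp add: Disj_def)

lemma degr_Conj [simp]: "degr e (Conj \<phi>s) \<le> D \<longleftrightarrow> (\<forall>\<phi>\<in>set \<phi>s. degr e \<phi> \<le> D)"
  by (induction \<phi>s) (auto simp: Conj_def)

lemma degr_Disj [simp]: "degr e (Disj \<phi>s) \<le> D \<longleftrightarrow> (\<forall>\<phi>\<in>set \<phi>s. degr e \<phi> \<le> D)"
  by (simp add: Disj_def)

section \<open>Independence and spanned sets as formulas over the input\<close>

definition inp :: "nat \<Rightarrow> nat \<Rightarrow> (nat \<Rightarrow> nat \<Rightarrow> bool) \<Rightarrow> store \<Rightarrow> bool" where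
  "inp n m M s \<longleftrightarrow> var s 0 = n \<and> var s 1 = m \<and> var s 7 = Suc n \<and>
     (\<forall>i j. s 2 [i, j] = 1 \<longleftrightarrow> i < m \<and> j < n \<and> M i j)"

lemma inp_agree: "agree k s s' \<Longrightarrow> 8 \<le> k \<Longrightarrow> inp n m M s \<Longrightarrow> inp n m M s'"
  by (simp add: agree_def inp_def readable_def)

lemma inp_upd: "inp n m M s \<Longrightarrow> 8 \<le> v \<Longrightarrow> inp n m M (upd s v [] i)"
  by (simp add: inp_def upd_def)

lemma map_var_upd: "v \<notin> set xs \<Longrightarrow> map (var (upd s v [] i)) xs = map (var s) xs"
  by (auto simp: upd_def)

text \<open>The entries of \<open>zs\<close> are names of variables holding columns. The row
  quantifiers stand side by side and share the variable \<open>k\<close>, so the degree is that of a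
  single range of rows, whatever the length of \<open>zs\<close>.\<close>

fun chain_fm :: "nat \<Rightarrow> nat list \<Rightarrow> fm" where
  "chain_fm k [] = Conj []"
| "chain_fm k (z # zs) = FAnd (FEx 1 k (FAnd (FBit 2 k z) (Conj (map (\<lambda>y. FNot (FBit 2 k y)) zs))))
     (chain_fm k zs)"

text \<open>Outside the matrix no entry reads as \<open>1\<close>, so the void entry
  \<open>n\<close> behaves like a zero column and has no row of its own. This is why a true formula
  forces all values below \<open>n\<close>.\<close>

lemma eval_chain:
  assumes "inp n m M s" "8 \<le> k" "k \<notin> set zs"
  shows "eval (chain_fm k zs) s \<longleftrightarrow> chain m M (map (var s) zs) \<and> var s ` set zs \<subseteq> {..<n}"
  using assms(3)
proof (induction zs)
  case (Cons z zs)
  have "k \<notin> set zs" using Cons.prems by simp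
  then have IH: "eval (chain_fm k zs) s \<longleftrightarrow> chain m M (map (var s) zs) \<and> var s ` set zs \<subseteq> {..<n}"
    by (rule Cons.IH)
  have bit: "eval (FBit 2 k y) (upd s k [] r) \<longleftrightarrow> r < m \<and> var s y < n \<and> M r (var s y)"
    if "y \<noteq> k" for y r
    using assms(1,2) that by (simp add: inp_def upd_def)
  have "(\<forall>y\<in>set zs. \<not> eval (FBit 2 k y) (upd s k [] r)) \<longleftrightarrow>
      (\<forall>y\<in>set zs. \<not> (r < m \<and> var s y < n \<and> M r (var s y)))" for r
    using bit Cons.prems by (metis list.set_intros(2))
  moreover have "eval (FBit 2 k z) (upd s k [] r) \<longleftrightarrow> r < m \<and> var s z < n \<and> M r (var s z)" for r
    using bit Cons.prems by (metis list.set_intros(1))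
  moreover have "var s 1 = m" using assms(1) by (simp add: inp_def)
  ultimately have ex: "eval (FEx 1 k (FAnd (FBit 2 k z) (Conj (map (\<lambda>y. FNot (FBit 2 k y)) zs)))) s \<longleftrightarrow>
      (\<exists>r<m. var s z < n \<and> M r (var s z) \<and> (\<forall>y\<in>set zs. \<not> (var s y < n \<and> M r (var s y))))"
    unfolding eval.simps(4,5) by (auto simp del: eval.simps(1))
  \<comment> \<open>The guards \<open>var s y < n\<close> in the negated atoms are supplied by the
    range condition that \<open>IH\<close> gives for the tail.\<close>
  show ?case unfolding chain_fm.simps eval.simps(4) IH ex by auto
qed simp

lemma wf_chain: "8 \<le> k \<Longrightarrow> \<forall>z\<in>set zs. readable k z \<Longrightarrow> wf_fm k (chain_fm k zs)"
  by (induction zs) (auto simp: readable_def)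

lemma degr_chain: "e 1 \<le> D \<Longrightarrow> degr e (chain_fm k zs) \<le> D"
proof (induction zs)
  case (Cons z zs)
  have "degr e (Conj (map (\<lambda>y. FNot (FBit 2 k y)) zs)) \<le> 0"
    unfolding degr_Conj by simp
  then show ?case using Cons by simp
qed simp

definition ind_fm :: "nat \<Rightarrow> nat list \<Rightarrow> fm" where
  "ind_fm k ys = Disj (map (\<lambda>zs. FAnd (chain_fm k zs)
       (Conj (map (\<lambda>y. Disj (FEq y 0 # map (FEq y) zs)) ys)))
     (concat (map (\<lambda>l. List.n_lists l ys) [0..<Suc (length ys)])))"

lemma eval_ind:
  assumes s: "inp n m M s" "8 \<le> k" "k \<notin> set ys" "var s ` set ys \<subseteq> {..n}"
  shows "eval (ind_fm k ys) s \<longleftrightarrow> elems n (map (var s) ys) \<in> faces {..<m} {..<n} M"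
    (is "_ \<longleftrightarrow> ?S \<in> _")
proof -
  have n: "var s 0 = n" using s(1) by (simp add: inp_def)
  have lists: "set (concat (map (\<lambda>l. List.n_lists l ys) [0..<Suc (length ys)])) =
      {zs. length zs \<le> length ys \<and> set zs \<subseteq> set ys}"
    by (auto simp: set_n_lists less_Suc_eq_le simp del: upt_Suc)
  have "eval (ind_fm k ys) s \<longleftrightarrow> (\<exists>zs. length zs \<le> length ys \<and> set zs \<subseteq> set ys \<and>
      eval (chain_fm k zs) s \<and> (\<forall>y\<in>set ys. var s y = n \<or> (\<exists>z\<in>set zs. var s y = var s z)))"
    unfolding ind_fm_def eval_Disj set_map lists by (simp add: n conj_assoc)
  also have "\<dots> \<longleftrightarrow> (\<exists>zs. length zs \<le> length ys \<and> set zs \<subseteq> set ys \<and>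
      chain m M (map (var s) zs) \<and> set (map (var s) zs) = ?S)" (is "?L \<longleftrightarrow> ?R")
  proof -
    have "eval (chain_fm k zs) s \<and> (\<forall>y\<in>set ys. var s y = n \<or> (\<exists>z\<in>set zs. var s y = var s z)) \<longleftrightarrow>
      chain m M (map (var s) zs) \<and> set (map (var s) zs) = ?S" if zs: "set zs \<subseteq> set ys" for zs
    proof -
      have "k \<notin> set zs" using zs s(3) by blast
      then show ?thesis
        using zs s(4) unfolding eval_chain[OF s(1,2) \<open>k \<notin> set zs\<close>]
        by (fastforce simp: elems_def image_subset_iff)
    qed
    then show ?thesis by blast
  qed
  also have "\<dots> \<longleftrightarrow> (\<exists>cs. set cs = ?S \<and> chain m M cs)"
  proof
    assume "\<exists>cs. set cs = ?S \<and> chain m M cs"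
    then obtain cs where cs: "set cs = ?S" "chain m M cs" by blast
    have "\<exists>y\<in>set ys. var s y = c" if "c \<in> set cs" for c
      using that cs(1) by (auto simp: elems_def)
    \<comment> \<open>\<open>f\<close> picks for every column of the chain a variable holding it;
      \<open>map f cs\<close> is then the required list of variables.\<close>
    then obtain f where f: "\<And>c. c \<in> set cs \<Longrightarrow> f c \<in> set ys \<and> var s (f c) = c" by metis
    have "map (var s) (map f cs) = cs" using f by (simp add: map_idI)
    moreover have "length cs \<le> length ys"
    proof -
      have "length cs = card ?S" using cs chain_distinct by (metis distinct_card)
      also have "\<dots> \<le> card (set (map (var s) ys))"
        by (intro card_mono) (auto simp: elems_def)
      also have "\<dots> \<le> length ys" by (metis card_length length_map)
      finally show ?thesis .
    qed
    ultimately show ?R using f cs by (intro exI[of _ "map f cs"]) auto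
  qed blast
  also have "\<dots> \<longleftrightarrow> ?S \<in> faces {..<m} {..<n} M"
    by (auto simp: faces_iff_chain elems_def)
  finally show ?thesis .
qed

lemma wf_ind: "8 \<le> k \<Longrightarrow> \<forall>y\<in>set ys. readable k y \<Longrightarrow> wf_fm k (ind_fm k ys)"
  by (auto simp: ind_fm_def set_n_lists subset_eq readable_0 simp del: upt_Suc intro!: wf_chain)

lemma degr_ind: "e 1 \<le> D \<Longrightarrow> degr e (ind_fm k ys) \<le> D"
  by (auto simp: ind_fm_def degr_chain)

definition span_fm :: "nat \<Rightarrow> nat list \<Rightarrow> nat \<Rightarrow> fm" where
  "span_fm k xs p = Disj (FNot (ind_fm k (p # xs)) # map (FEq p) xs)"

lemma eval_span:
  assumes "inp n m M s" "8 \<le> k" "k \<notin> set xs" "k \<noteq> p" "var s ` set xs \<subseteq> {..n}" "var s p < n"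
  shows "eval (span_fm k xs p) s \<longleftrightarrow>
    var s p \<in> spanned {..<n} (faces {..<m} {..<n} M) (elems n (map (var s) xs))"
proof -
  have "elems n (map (var s) (p # xs)) = insert (var s p) (elems n (map (var s) xs))"
    using assms(6) by (auto simp: elems_def)
  moreover have "eval (ind_fm k (p # xs)) s \<longleftrightarrow>
      elems n (map (var s) (p # xs)) \<in> faces {..<m} {..<n} M"
    using assms by (intro eval_ind) auto
  ultimately show ?thesis using assms(6) by (auto simp: span_fm_def spanned_def elems_def)
qed

lemma wf_span: "8 \<le> k \<Longrightarrow> \<forall>y\<in>set xs. readable k y \<Longrightarrow> readable k p \<Longrightarrow> wf_fm k (span_fm k xs p)"
  by (auto simp: span_fm_def wf_ind)

lemma degr_span: "e 1 \<le> D \<Longrightarrow> degr e (span_fm k xs p) \<le> D"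
  by (auto simp: span_fm_def degr_ind)

section \<open>Quantification over tuples, flatness and novelty\<close>

fun exs :: "nat list \<Rightarrow> fm \<Rightarrow> fm" where
  "exs [] \<phi> = \<phi>"
| "exs (v # vs) \<phi> = FEx 7 v (exs vs \<phi>)"

fun upds :: "store \<Rightarrow> nat list \<Rightarrow> nat list \<Rightarrow> store" where
  "upds s (v # vs) (i # l) = upds (upd s v [] i) vs l"
| "upds s _ _ = s"

lemma upds_other: "x \<notin> set vs \<Longrightarrow> upds s vs l x = s x"
  by (induction s vs l rule: upds.induct) (auto simp: upd_def)

lemma map_upds: "distinct vs \<Longrightarrow> length l = length vs \<Longrightarrow> map (var (upds s vs l)) vs = l"
  by (induction s vs l rule: upds.induct) (auto simp: upds_other upd_def)

lemma tuples_Suc: "tuples n (Suc k) = {i # l | i l. i < Suc n \<and> l \<in> tuples n k}"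
  by (auto simp: tuples_def length_Suc_conv less_Suc_eq_le)

text \<open>Variable \<open>7\<close> holds \<open>n + 1\<close>, so each quantifier of the block
  ranges over the columns and the void entry \<open>n\<close>.\<close>

lemma eval_exs:
  assumes "var s 7 = Suc n" "7 \<notin> set vs"
  shows "eval (exs vs \<phi>) s \<longleftrightarrow> (\<exists>l\<in>tuples n (length vs). eval \<phi> (upds s vs l))"
  using assms
proof (induction vs arbitrary: s)
  case Nil
  then show ?case by (auto simp: tuples_def)
next
  case (Cons v vs)
  have "eval (exs vs \<phi>) (upd s v [] i) \<longleftrightarrow>
      (\<exists>l\<in>tuples n (length vs). eval \<phi> (upds (upd s v [] i) vs l))" for i
    using Cons.prems by (intro Cons.IH) (auto simp: upd_def)
  then show ?case using Cons.prems by (fastforce simp: tuples_Suc)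
qed

lemma wf_exs: "wf_fm (k + l) \<phi> \<Longrightarrow> wf_fm k (exs [k..<k + l] \<phi>)"
proof (induction l arbitrary: k)
  case (Suc l)
  have "[k..<k + Suc l] = k # [Suc k..<Suc k + l]" by (simp add: upt_conv_Cons del: upt_Suc)
  moreover have "wf_fm (Suc k) (exs [Suc k..<Suc k + l] \<phi>)" using Suc.prems by (intro Suc.IH) simp
  ultimately show ?case by (simp del: upt_Suc)
qed simp

lemma degr_exs: "degr e (exs vs \<phi>) = e 7 * length vs + degr e \<phi>"
  by (induction vs) simp_all

text \<open>
  \<open>ys\<close> ranges over the faces inside the set spanned by \<open>xs\<close>, and \<open>p\<close> over the columns
  outside; the faces have at most \<open>d + 1\<close> elements.
\<close>

definition flat_fm :: "nat \<Rightarrow> nat \<Rightarrow> nat list \<Rightarrow> fm" where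
  "flat_fm d k xs = (let p = k + Suc d; r = Suc p; ys = [k..<p] in
     FNot (exs ys (FEx 0 p (Conj
       (FNot (span_fm r xs p) # ind_fm r ys # FNot (ind_fm r (p # ys)) #
        map (\<lambda>y. Disj [FEq y 0, span_fm r xs y]) ys)))))"

lemma eval_flat:
  assumes s: "inp n m M s" "8 \<le> k" "\<forall>x\<in>set xs. x < k" "var s ` set xs \<subseteq> {..n}"
    and card: "\<And>I. I \<in> faces {..<m} {..<n} M \<Longrightarrow> card I \<le> Suc d"
  defines "X \<equiv> spanned {..<n} (faces {..<m} {..<n} M) (elems n (map (var s) xs))"
  shows "eval (flat_fm d k xs) s \<longleftrightarrow> X \<in> flats {..<n} (faces {..<m} {..<n} M)"
proof -
  let ?H = "faces {..<m} {..<n} M"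
  define p where "p = k + Suc d"
  define ys where "ys = [k..<p]"
  have ys: "length ys = Suc d" "distinct ys" by (simp_all add: ys_def p_def)
  have sX: "X \<subseteq> {..<n}" by (auto simp: X_def spanned_def)
  define \<psi> where "\<psi> = Conj
       (FNot (span_fm (Suc p) xs p) # ind_fm (Suc p) ys # FNot (ind_fm (Suc p) (p # ys)) #
        map (\<lambda>y. Disj [FEq y 0, span_fm (Suc p) xs y]) ys)"
  have ev: "eval \<psi> (upd (upds s ys l) p [] q) \<longleftrightarrow>
      q \<notin> X \<and> elems n l \<in> ?H \<and> insert q (elems n l) \<notin> ?H \<and> elems n l \<subseteq> X"
    if l: "l \<in> tuples n (Suc d)" and q: "q < n" for l q
  proof -
    define s' where "s' = upd (upds s ys l) p [] q"
    have "inp n m M (upds s ys l)" using s(1,2) by (auto simp: inp_def upds_other ys_def)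
    then have inp: "inp n m M s'" using s(2) by (simp add: s'_def inp_upd p_def)
    have "x < k \<Longrightarrow> var s' x = var s x" for x
      by (simp add: s'_def upd_def upds_other ys_def p_def)
    then have xs: "map (var s') xs = map (var s) xs" using s(3) by simp
    then have xs': "var s' ` set xs \<subseteq> {..n}" using s(4) by (metis set_map)
    have "map (var s') ys = map (var (upds s ys l)) ys"
      unfolding s'_def by (rule map_var_upd) (simp add: ys_def)
    also have "\<dots> = l" using ys l by (intro map_upds) (auto simp: tuples_def)
    finally have vys: "map (var s') ys = l" .
    then have ys': "var s' ` set ys = set l" by (metis set_map)
    have ln: "set l \<subseteq> {..n}" using l by (simp add: tuples_def)
    have p: "var s' p = q" by (simp add: s'_def upd_def)
    have k: "8 \<le> Suc p" "Suc p \<notin> set xs" "Suc p \<notin> set ys" "Suc p \<noteq> p"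
      using s(2,3) by (auto simp: p_def ys_def)
    have 1: "eval (span_fm (Suc p) xs y) s' \<longleftrightarrow> var s' y \<in> X"
      if "y \<noteq> Suc p" "var s' y < n" for y
      using eval_span[OF inp k(1,2) that(1)[symmetric] xs' that(2)] xs by (simp add: X_def)
    have 2: "eval (ind_fm (Suc p) ys) s' \<longleftrightarrow> elems n l \<in> ?H"
      using eval_ind[OF inp k(1,3)] ys' ln vys by simp
    have "elems n (map (var s') (p # ys)) = insert q (elems n l)"
      using vys p q by (auto simp: elems_def)
    then have 3: "eval (ind_fm (Suc p) (p # ys)) s' \<longleftrightarrow> insert q (elems n l) \<in> ?H"
      using eval_ind[OF inp k(1), of "p # ys"] k ys' ln p q by auto
    \<comment> \<open>The formula for the spanned set is meaningful only at values below
      \<open>n\<close>; void entries are accepted by the first disjunct.\<close>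
    have "(\<forall>y\<in>set ys. var s' y = n \<or> eval (span_fm (Suc p) xs y) s') \<longleftrightarrow>
        (\<forall>y\<in>set ys. var s' y = n \<or> var s' y \<in> X)"
    proof (intro ball_cong refl)
      fix y assume "y \<in> set ys"
      then have "y \<noteq> Suc p" "var s' y \<le> n" using k(3) ys' ln by auto
      then show "(var s' y = n \<or> eval (span_fm (Suc p) xs y) s') \<longleftrightarrow>
        (var s' y = n \<or> var s' y \<in> X)" using 1[of y] by (cases "var s' y = n") auto
    qed
    also have "\<dots> \<longleftrightarrow> (\<forall>i\<in>set l. i = n \<or> i \<in> X)" unfolding ys'[symmetric] by blast
    also have "\<dots> \<longleftrightarrow> elems n l \<subseteq> X" using ln by (force simp: elems_def)
    finally have 4: "(\<forall>y\<in>set ys. var s' y = n \<or> eval (span_fm (Suc p) xs y) s') \<longleftrightarrow>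
      elems n l \<subseteq> X" .
    have "var s' 0 = n" using inp by (simp add: inp_def)
    then show ?thesis
      using 1[of p] 2 3 4 p q unfolding s'_def[symmetric] \<psi>_def by simp
  qed
  have "eval (flat_fm d k xs) s \<longleftrightarrow> \<not> eval (exs ys (FEx 0 p \<psi>)) s"
    by (simp add: flat_fm_def Let_def p_def ys_def \<psi>_def)
  also have "\<dots> \<longleftrightarrow> \<not> (\<exists>l\<in>tuples n (Suc d). eval (FEx 0 p \<psi>) (upds s ys l))"
    using s(1,2) ys(1) by (subst eval_exs[where n = n]) (auto simp: inp_def ys_def)
  also have "\<dots> \<longleftrightarrow> \<not> (\<exists>l\<in>tuples n (Suc d). \<exists>q<n. q \<notin> X \<and> elems n l \<in> ?H \<and>
      insert q (elems n l) \<notin> ?H \<and> elems n l \<subseteq> X)"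
  proof -
    have "var (upds s ys l) 0 = n" for l using s(1,2) by (simp add: inp_def upds_other ys_def)
    then show ?thesis using ev by auto
  qed
  also have "\<dots> \<longleftrightarrow> (\<forall>I\<in>?H. I \<subseteq> X \<longrightarrow> (\<forall>q\<in>{..<n} - X. insert q I \<in> ?H))"
  proof -
    \<comment> \<open>No counterexample to flatness escapes, because the bound on the size of faces
      makes each of them the value of some tuple.\<close>
    have "\<exists>l\<in>tuples n (Suc d). elems n l = I" if "I \<in> ?H" for I
      using that card[OF that] by (intro ex_tuple) (auto simp: faces_iff_chain)
    then show ?thesis by (metis DiffD1 DiffD2 DiffI lessThan_iff)
  qed
  also have "\<dots> \<longleftrightarrow> X \<in> flats {..<n} ?H" using sX by (simp add: flats_def)
  finally show ?thesis .
qed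

lemma wf_flat:
  assumes "8 \<le> k" "\<forall>x\<in>set xs. readable k x"
  shows "wf_fm k (flat_fm d k xs)"
proof -
  define p where "p = k + Suc d"
  have "8 \<le> Suc p" "\<forall>x\<in>set xs. readable (Suc p) x" "\<forall>y\<in>set [k..<p]. readable (Suc p) y"
    "readable (Suc p) p" "readable (Suc p) 0"
    using assms unfolding p_def readable_def by auto
  then show ?thesis
    unfolding flat_fm_def Let_def wf_fm.simps(3) p_def[symmetric]
    unfolding p_def by (intro wf_exs) (simp add: wf_span wf_ind del: upt_Suc)
qed

lemma degr_flat: "degr e (flat_fm d k xs) \<le> e 7 * Suc d + e 0 + e 1"
  by (auto simp: flat_fm_def Let_def degr_exs degr_span degr_ind)

text \<open>The innermost conjunction is the exclusive or of \<open>\<phi>\<close> and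
  \<open>\<psi>\<close>: in each listed set, some column tells it apart from the set spanned by
  \<open>xs\<close>.\<close>

definition new_fm :: "nat \<Rightarrow> nat list \<Rightarrow> fm" where
  "new_fm k xs = (let \<phi> = FBit 4 k (Suc k); \<psi> = span_fm (Suc (Suc k)) xs (Suc k) in
     FNot (FEx 3 k (FNot (FEx 0 (Suc k)
       (FAnd (FNot (FAnd \<phi> \<psi>)) (FNot (FAnd (FNot \<phi>) (FNot \<psi>))))))))"

lemma eval_new:
  assumes s: "inp n m M s" "8 \<le> k" "\<forall>x\<in>set xs. x < k" "var s ` set xs \<subseteq> {..n}"
  defines "X \<equiv> spanned {..<n} (faces {..<m} {..<n} M) (elems n (map (var s) xs))"
  shows "eval (new_fm k xs) s \<longleftrightarrow> X \<notin> set (output_list n s)"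
proof -
  have sX: "X \<subseteq> {..<n}" by (auto simp: X_def spanned_def)
  have ev: "eval (span_fm (Suc (Suc k)) xs (Suc k)) (upd (upd s k [] i) (Suc k) [] q) \<longleftrightarrow> q \<in> X"
    if "q < n" for i q
  proof -
    let ?s = "upd (upd s k [] i) (Suc k) [] q"
    have "var ?s x = var s x" if "x < k" for x using that by (simp add: upd_def)
    then have xs: "map (var ?s) xs = map (var s) xs" using s(3) by simp
    then have xs': "var ?s ` set xs \<subseteq> {..n}" using s(4) by (metis set_map)
    have inp: "inp n m M ?s" using s(1,2) by (intro inp_upd) auto
    have q: "var ?s (Suc k) = q" by (simp add: upd_def)
    have "8 \<le> Suc (Suc k)" "Suc (Suc k) \<notin> set xs" "Suc (Suc k) \<noteq> Suc k" "var ?s (Suc k) < n"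
      using s(2,3) q that by auto
    from eval_span[OF inp this(1-3) xs' this(4)] show ?thesis
      unfolding q xs X_def .
  qed
  have bit: "eval (FBit 4 k (Suc k)) (upd (upd s k [] i) (Suc k) [] q) \<longleftrightarrow> s 4 [i, q] = 1" for i q
    using s(2) by (simp add: upd_def)
  have v0: "var (upd s k [] i) 0 = n" for i using s(1,2) by (simp add: inp_def upd_def)
  have "eval (new_fm k xs) s \<longleftrightarrow> \<not> (\<exists>i<var s 3. \<forall>q<n. s 4 [i, q] = 1 \<longleftrightarrow> q \<in> X)"
    unfolding new_fm_def Let_def eval.simps(3-5) v0 bit
    by (auto simp: ev simp del: eval.simps)
  also have "\<dots> \<longleftrightarrow> X \<notin> set (output_list n s)"
  proof -
    have "(\<forall>q<n. s 4 [i, q] = 1 \<longleftrightarrow> q \<in> X) \<longleftrightarrow> {j. j < n \<and> s 4 [i, j] = 1} = X" for i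
      using sX by auto
    then show ?thesis by (auto simp: output_list_def)
  qed
  finally show ?thesis .
qed

lemma wf_new: "8 \<le> k \<Longrightarrow> \<forall>x\<in>set xs. readable k x \<Longrightarrow> wf_fm k (new_fm k xs)"
  by (auto simp: new_fm_def Let_def readable_def intro!: wf_span)

lemma degr_new: "degr e (new_fm k xs) \<le> e 3 + e 0 + e 1"
  by (simp add: new_fm_def Let_def degr_span)

section \<open>Loops and the program\<close>

definition for_loop :: "nat \<Rightarrow> nat \<Rightarrow> com \<Rightarrow> com" where
  "for_loop v b c = Seq (Const v 0) (While (Less v b) (Seq c (Inc v)))"

text \<open>The invariant \<open>I i\<close> refers to the moment before a guard test, so the body
  has to establish it for the store in which the counter has already been advanced. Each round costs
  2 on top of the body, and the last test costs 1.\<close>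

lemma exec_while_up:
  assumes step: "\<And>i s. i < B \<Longrightarrow> var s v = i \<Longrightarrow> var s b = B \<Longrightarrow> I i s \<Longrightarrow> \<exists>t s'. exec c s t s' \<and> t \<le> T \<and>
      var s' v = i \<and> var s' b = B \<and> I (Suc i) (upd s' v [] (Suc i))"
    and "b \<noteq> v" "i \<le> B" "var s v = i" "var s b = B" "I i s"
  shows "\<exists>t s'. exec (While (Less v b) (Seq c (Inc v))) s t s' \<and> t \<le> 1 + (B - i) * (T + 2) \<and> I B s'"
    (is "\<exists>t s'. exec ?W s t s' \<and> _")
  using assms(3-)
proof (induction "B - i" arbitrary: s i)
  case 0
  then have "exec ?W s 1 s" by (intro exec.WhileFalse) simp
  then show ?case using 0 by (intro exI[of _ 1] exI[of _ s]) simp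
next
  case (Suc r)
  then have iB: "i < B" by simp
  from step[OF this Suc.prems(2-4)] obtain t1 s1 where
    1: "exec c s t1 s1" "t1 \<le> T" "var s1 v = i" "var s1 b = B" "I (Suc i) (upd s1 v [] (Suc i))" by blast
  define s2 where "s2 = upd s1 v [] (Suc i)"
  have "exec (Inc v) s1 1 s2" using 1(3) by (intro exec_IncI) (simp_all add: s2_def)
  with 1(1) have body: "exec (Seq c (Inc v)) s (t1 + 1) s2" by (rule exec.Seq)
  have "\<exists>t s'. exec ?W s2 t s' \<and> t \<le> 1 + (B - Suc i) * (T + 2) \<and> I B s'"
    using Suc.hyps(2) iB 1 \<open>b \<noteq> v\<close> by (intro Suc.hyps(1)) (auto simp: s2_def upd_def)
  then obtain t3 s3 where 3: "exec ?W s2 t3 s3" "t3 \<le> 1 + (B - Suc i) * (T + 2)" "I B s3" by blast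
  have "holds (Less v b) s" using iB Suc.prems by simp
  from exec.WhileTrue[OF this body 3(1)] have "exec ?W s (1 + (t1 + 1) + t3) s3" .
  moreover have "1 + (t1 + 1) + t3 \<le> 1 + (B - i) * (T + 2)"
  proof -
    have "B - i = Suc (B - Suc i)" using iB by simp
    then show ?thesis using 1(2) 3(2) by simp
  qed
  ultimately show ?case using 3(3) by blast
qed

lemma exec_for_loop:
  assumes "\<And>i s. i < B \<Longrightarrow> var s v = i \<Longrightarrow> var s b = B \<Longrightarrow> I i s \<Longrightarrow> \<exists>t s'. exec c s t s' \<and> t \<le> T \<and>
      var s' v = i \<and> var s' b = B \<and> I (Suc i) (upd s' v [] (Suc i))"
    and "b \<noteq> v" "var s b = B" "I 0 (upd s v [] 0)"
  shows "\<exists>t s'. exec (for_loop v b c) s t s' \<and> t \<le> 2 + B * (T + 2) \<and> I B s'"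
proof -
  have "\<exists>t s'. exec (While (Less v b) (Seq c (Inc v))) (upd s v [] 0) t s' \<and>
      t \<le> 1 + (B - 0) * (T + 2) \<and> I B s'"
    using assms(2-4) by (intro exec_while_up[where I = I, OF assms(1)]) (auto simp: upd_def)
  then obtain t s' where t: "exec (While (Less v b) (Seq c (Inc v))) (upd s v [] 0) t s'"
      "t \<le> 1 + B * (T + 2)" "I B s'" by auto
  have "exec (for_loop v b c) s (1 + t) s'"
    unfolding for_loop_def by (rule exec.Seq[OF exec.Const t(1)])
  then show ?thesis using t by (intro exI[of _ "1 + t"] exI[of _ s']) simp
qed

fun nest :: "nat list \<Rightarrow> com \<Rightarrow> com" where
  "nest [] c = c"
| "nest (v # vs) c = for_loop v 7 (nest vs c)"

text \<open>\<open>Q D\<close> is the invariant after the body has been executed for the set \<open>D\<close> of tuples.\<close>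

lemma exec_nest:
  assumes body: "\<And>D s. Q D s \<Longrightarrow> map (var s) xs \<in> tuples n (length xs) \<Longrightarrow> \<exists>t s'. exec c s t s' \<and>
      t \<le> T \<and> Q (insert (map (var s) xs) D) s' \<and> (\<forall>x\<in>set xs. var s' x = var s x)"
    and bnd: "\<And>D s. Q D s \<Longrightarrow> var s 7 = Suc n"
    and ins: "\<And>D s v i. Q D s \<Longrightarrow> v \<in> set xs \<Longrightarrow> Q D (upd s v [] i)"
    and xs: "xs = pre @ vs" "distinct xs" "7 \<notin> set xs"
    and "Q D s" "var s ` set pre \<subseteq> {..n}"
  shows "\<exists>t s'. exec (nest vs c) s t s' \<and> t \<le> (T + 4 * length vs) * Suc n ^ length vs \<and>
      Q (D \<union> {map (var s) pre @ l | l. l \<in> tuples n (length vs)}) s' \<and>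
      (\<forall>x\<in>set pre. var s' x = var s x)"
  using assms(4,7-)
proof (induction vs arbitrary: pre D s)
  case Nil
  have "map (var s) pre \<in> tuples n (length pre)" using Nil by (auto simp: tuples_def)
  then obtain t s' where "exec c s t s'" "t \<le> T" "Q (insert (map (var s) xs) D) s'"
    "\<forall>x\<in>set xs. var s' x = var s x" using body[of D s] Nil by auto
  moreover have "D \<union> {map (var s) pre @ l | l. l \<in> tuples n 0} = insert (map (var s) xs) D"
    using Nil by (auto simp: tuples_def)
  ultimately show ?case using Nil by auto
next
  case (Cons v vs)
  define T' where "T' = (T + 4 * length vs) * Suc n ^ length vs"
  \<comment> \<open>When the counter \<open>v\<close> stands at \<open>i\<close>, the finished
    tuples extending \<open>pre\<close> are those whose next entry is below \<open>i\<close>. At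
    \<open>Suc n\<close> these are all of them, including those with the void entry.\<close>
  define D' where "D' i = D \<union> {map (var s) pre @ j # l | j l. j < i \<and> l \<in> tuples n (length vs)}" for i
  define I where "I i r \<longleftrightarrow> Q (D' i) r \<and> (\<forall>x\<in>set pre. var r x = var s x)" for i r
  have v: "v \<in> set xs" "v \<notin> set pre" "v \<noteq> 7" using Cons.prems(1) xs(2,3) by auto
  have "\<exists>t s'. exec (for_loop v 7 (nest vs c)) s t s' \<and> t \<le> 2 + Suc n * (T' + 2) \<and> I (Suc n) s'"
  proof (rule exec_for_loop)
    show "7 \<noteq> v" using v by simp
    show "var s 7 = Suc n" using bnd Cons.prems by blast
    have "D' 0 = D" by (simp add: D'_def)
    then show "I 0 (upd s v [] 0)" using Cons.prems ins v by (auto simp: I_def upd_def)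
  next
    fix i r assume i: "i < Suc n" "var r v = i" "var r 7 = Suc n" "I i r"
    have pre: "map (var r) pre = map (var s) pre" using i(4) by (auto simp: I_def)
    have "\<exists>t s'. exec (nest vs c) r t s' \<and> t \<le> (T + 4 * length vs) * Suc n ^ length vs \<and>
      Q (D' i \<union> {map (var r) (pre @ [v]) @ l | l. l \<in> tuples n (length vs)}) s' \<and>
      (\<forall>x\<in>set (pre @ [v]). var s' x = var r x)"
    proof (rule Cons.IH)
      show "xs = (pre @ [v]) @ vs" using Cons.prems by simp
      show "Q (D' i) r" using i(4) by (simp add: I_def)
      show "var r ` set (pre @ [v]) \<subseteq> {..n}" using i Cons.prems(3) by (auto simp: I_def)
    qed
    then obtain t r' where r': "exec (nest vs c) r t r'" "t \<le> T'"
      "Q (D' i \<union> {map (var r) (pre @ [v]) @ l | l. l \<in> tuples n (length vs)}) r'"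
      "\<forall>x\<in>set (pre @ [v]). var r' x = var r x" unfolding T'_def by blast
    have "D' i \<union> {map (var r) (pre @ [v]) @ l | l. l \<in> tuples n (length vs)} = D' (Suc i)"
      using pre i(2) by (auto simp: D'_def less_Suc_eq)
    then have "Q (D' (Suc i)) r'" using r'(3) by simp
    then have "I (Suc i) (upd r' v [] (Suc i))" using ins v r'(4) i(4) by (auto simp: I_def upd_def)
    moreover have "var r' 7 = Suc n" using bnd r'(3) by blast
    ultimately show "\<exists>t s'. exec (nest vs c) r t s' \<and> t \<le> T' \<and> var s' v = i \<and> var s' 7 = Suc n \<and>
      I (Suc i) (upd s' v [] (Suc i))" using r' i(2) by auto
  qed
  then obtain t s' where 1: "exec (for_loop v 7 (nest vs c)) s t s'" "t \<le> 2 + Suc n * (T' + 2)"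
    "I (Suc n) s'" by blast
  have "D' (Suc n) = D \<union> {map (var s) pre @ l | l. l \<in> tuples n (length (v # vs))}"
    by (auto simp: D'_def tuples_Suc)
  moreover have "2 + Suc n * (T' + 2) \<le> (T + 4 * length (v # vs)) * Suc n ^ length (v # vs)"
  proof -
    \<comment> \<open>One more loop adds \<open>2 + 2 * Suc n\<close>, which is at most
      \<open>4 * Suc n\<close>; hence the summand 4 per level in the bound.\<close>
    have "Suc n * 1 \<le> Suc n * Suc n ^ length vs" by (intro mult_le_mono2) simp
    moreover have "(T + 4 * length (v # vs)) * Suc n ^ length (v # vs) =
        Suc n * T' + 4 * (Suc n * Suc n ^ length vs)"
      by (simp add: T'_def algebra_simps)
    moreover have "2 + Suc n * (T' + 2) = 2 + Suc n * T' + 2 * Suc n" by (simp add: algebra_simps)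
    ultimately show ?thesis by simp
  qed
  ultimately show ?case using 1 by (auto simp: I_def intro!: exI[of _ t] exI[of _ s'])
qed

section \<open>The program and the sizes of its ranges\<close>

definition base_vars :: "nat \<Rightarrow> nat list" where
  "base_vars d = [8..<9 + d]"

definition good_fm :: "nat \<Rightarrow> fm" where
  "good_fm d = Conj [ind_fm (9 + d) (base_vars d), flat_fm d (9 + d) (base_vars d),
     new_fm (9 + d) (base_vars d)]"

text \<open>The row being written has the current length of the list as its index. It joins the list
  only when \<open>step_com\<close> increments variable \<open>3\<close> afterwards.\<close>

definition write_row :: "nat \<Rightarrow> com" where
  "write_row d = for_loop (9 + d) 0
     (Seq (compile (span_fm (10 + d) (base_vars d) (9 + d))) (Store 4 [3, 9 + d] 5))"

definition step_com :: "nat \<Rightarrow> com" where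
  "step_com d = Seq (compile (good_fm d))
     (Seq (Const 6 1) (If (Eq 5 6) (Seq (write_row d) (Inc 3)) Skip))"

text \<open>Names \<open>0\<close> to \<open>7\<close> are reserved, so the \<open>d + 1\<close>
  loop counters that form the tuple start at \<open>8\<close>.\<close>

definition flats_com :: "nat \<Rightarrow> com" where
  "flats_com d = Seq (Load 7 0 []) (Seq (Inc 7) (nest (base_vars d) (step_com d)))"

text \<open>Ranges as powers of \<open>n + 1\<close>: exponent \<open>d\<close> for the rows,
  \<open>d + 1\<close> for the list of flats found so far, and \<open>1\<close> for columns and
  tuple entries.\<close>

definition bound_exp :: "nat \<Rightarrow> nat \<Rightarrow> nat" where
  "bound_exp d b = (if b = 1 then d else if b = 3 then Suc d else 1)"

lemma bound_exp_simps [simp]: "bound_exp d 0 = 1" "bound_exp d 1 = d" "bound_exp d (Suc 0) = d"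
    "bound_exp d 3 = Suc d" "bound_exp d 7 = 1"
  by (simp_all add: bound_exp_def)

lemma var_bounds:
  assumes "inp n m M s" "m \<le> Suc n ^ d" "var s 3 \<le> Suc n ^ Suc d" "b \<in> {0, 1, 3, 7}"
  shows "var s b \<le> Suc n ^ bound_exp d b"
  using assms by (auto simp: inp_def)

lemma base_vars_readable: "\<forall>x\<in>set (base_vars d). readable (9 + d) x"
  by (auto simp: base_vars_def readable_def)

lemma wf_good: "wf_fm (9 + d) (good_fm d)"
  using base_vars_readable[of d] by (auto simp: good_fm_def intro!: wf_ind wf_flat wf_new)

text \<open>Flatness and novelty both reach \<open>(d + 1) + 1 + d\<close>: a tuple or a list index,
  then a column, then a row inside the independence test.\<close>

lemma degr_good: "degr (bound_exp d) (good_fm d) \<le> 2 * d + 2"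
  using degr_flat[of "bound_exp d" d "9 + d" "base_vars d"] degr_new[of "bound_exp d" "9 + d" "base_vars d"]
    degr_ind[of "bound_exp d" "2 * d + 2" "9 + d" "base_vars d"]
  by (simp add: good_fm_def)

lemma exec_write_row:
  assumes s: "inp n m M s" "m \<le> Suc n ^ d" "var s 3 \<le> Suc n ^ Suc d"
    "map (var s) (base_vars d) \<in> tuples n (Suc d)"
  defines "X \<equiv> spanned {..<n} (faces {..<m} {..<n} M) (elems n (map (var s) (base_vars d)))"
    and "C \<equiv> cost (span_fm (10 + d) (base_vars d) (9 + d))"
  shows "\<exists>t s'. exec (write_row d) s t s' \<and> t \<le> 2 + n * (C * Suc n ^ d + 5) \<and>
    (\<forall>x. readable (9 + d) x \<longrightarrow> var s' x = var s x) \<and> s' 2 = s 2 \<and>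
    s' 4 = (\<lambda>idx. if \<exists>j<n. idx = [var s 3, j] then of_bool (idx ! 1 \<in> X) else s 4 idx)"
proof -
  let ?v = "9 + d"
  \<comment> \<open>Array \<open>4\<close> is described completely, because the rows already written
    must be known to stay intact.\<close>
  define I where "I i r \<longleftrightarrow> (\<forall>x. readable ?v x \<longrightarrow> var r x = var s x) \<and> r 2 = s 2 \<and>
    r 4 = (\<lambda>idx. if \<exists>j<i. idx = [var s 3, j] then of_bool (idx ! 1 \<in> X) else s 4 idx)" for i :: nat and r
  have "\<exists>t s'. exec (write_row d) s t s' \<and> t \<le> 2 + n * ((C * Suc n ^ d + 3) + 2) \<and> I n s'"
    unfolding write_row_def
  proof (rule exec_for_loop)
    show "0 \<noteq> ?v" by simp
    show "var s 0 = n" using s(1) by (simp add: inp_def)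
    show "I 0 (upd s ?v [] 0)" by (auto simp: I_def upd_def readable_def)
  next
    fix i r assume r: "i < n" "var r ?v = i" "var r 0 = n" "I i r"
    have I: "\<And>x. readable ?v x \<Longrightarrow> var r x = var s x" "r 2 = s 2"
      "r 4 = (\<lambda>idx. if \<exists>j<i. idx = [var s 3, j] then of_bool (idx ! 1 \<in> X) else s 4 idx)"
      using r(4) by (auto simp: I_def)
    have inp: "inp n m M r" using I(1)[of 0] I(1)[of 1] I(1)[of 7] I(2) s(1)
      by (auto simp: inp_def readable_def)
    have v3: "var r 3 = var s 3" using I(1)[of 3] by (simp add: readable_def)
    have xs: "map (var r) (base_vars d) = map (var s) (base_vars d)"
      using I(1) base_vars_readable by auto
    have le: "var r ` set (base_vars d) \<subseteq> {..n}"
      using s(4) xs unfolding tuples_def by (metis (lifting) mem_Collect_eq set_map)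
    let ?\<phi> = "span_fm (10 + d) (base_vars d) ?v"
    have "\<exists>t r'. exec (compile ?\<phi>) r t r' \<and> t \<le> cost ?\<phi> * Suc n ^ degr (bound_exp d) ?\<phi> \<and>
        agree (10 + d) r r' \<and> var r' 5 = of_bool (eval ?\<phi> r)"
    proof (rule compile_correct)
      show "wf_fm (10 + d) ?\<phi>"
        using base_vars_readable[of d] by (intro wf_span) (auto simp: readable_def)
      show "var r b \<le> Suc n ^ bound_exp d b" if "b \<in> {0, 1, 3, 7}" for b
        using inp s(2,3) that v3 by (intro var_bounds) auto
    qed auto
    then obtain t r' where t: "exec (compile ?\<phi>) r t r'" "t \<le> C * Suc n ^ degr (bound_exp d) ?\<phi>"
      "agree (10 + d) r r'" "var r' 5 = of_bool (eval ?\<phi> r)" unfolding C_def by blast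
    have "eval ?\<phi> r \<longleftrightarrow> var r ?v \<in> X"
      unfolding X_def xs[symmetric] using r le
      by (intro eval_span[OF inp]) (auto simp: base_vars_def)
    then have v5: "var r' 5 = of_bool (i \<in> X)" using t(4) r(2) by simp
    have ag: "\<And>x. readable (10 + d) x \<Longrightarrow> var r' x = var r x" "r' 2 = r 2" "r' 4 = r 4"
      using t(3) by (auto simp: agree_def)
    have rv: "var r' ?v = i" "var r' 3 = var s 3" "var r' 0 = n"
      using ag(1)[of ?v] ag(1)[of 3] ag(1)[of 0] r v3 by (auto simp: readable_def)
    define r'' where "r'' = upd r' 4 [var s 3, i] (of_bool (i \<in> X))"
    have "exec (Store 4 [3, ?v] 5) r' 3 r''"
      using rv v5 by (intro exec_StoreI) (simp_all add: r''_def)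
    with t(1) have "exec (Seq (compile ?\<phi>) (Store 4 [3, ?v] 5)) r (t + 3) r''" by (rule exec.Seq)
    moreover have "t + 3 \<le> C * Suc n ^ d + 3"
    proof -
      have "Suc n ^ degr (bound_exp d) ?\<phi> \<le> Suc n ^ d"
        by (intro power_increasing degr_span) auto
      then have "C * Suc n ^ degr (bound_exp d) ?\<phi> \<le> C * Suc n ^ d" by (rule mult_le_mono2)
      then show ?thesis using t(2) by linarith
    qed
    moreover have "I (Suc i) (upd r'' ?v [] (Suc i))"
      unfolding I_def
    proof (intro conjI allI impI)
      fix x assume x: "readable ?v x"
      then have "readable (10 + d) x" "x \<noteq> ?v" by (auto simp: readable_def)
      then show "var (upd r'' ?v [] (Suc i)) x = var s x"
        using ag(1) I(1) x by (auto simp: r''_def upd_def)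
    qed (use ag I in \<open>auto simp: r''_def upd_def fun_eq_iff less_Suc_eq\<close>)
    ultimately show "\<exists>t r'. exec (Seq (compile ?\<phi>) (Store 4 [3, ?v] 5)) r t r' \<and>
      t \<le> C * Suc n ^ d + 3 \<and> var r' ?v = i \<and> var r' 0 = n \<and> I (Suc i) (upd r' ?v [] (Suc i))"
      using rv by (intro exI[of _ "t + 3"] exI[of _ r'']) (auto simp: r''_def upd_def)
  qed
  moreover have "(C * Suc n ^ d + 3) + 2 = C * Suc n ^ d + 5" by simp
  ultimately show ?thesis unfolding I_def by (simp only:)
qed

section \<open>The invariant over the processed tuples\<close>

definition outputs :: "nat \<Rightarrow> nat \<Rightarrow> (nat \<Rightarrow> nat \<Rightarrow> bool) \<Rightarrow> nat list set \<Rightarrow> store \<Rightarrow> bool" where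
  "outputs n m M D s \<longleftrightarrow> inp n m M s \<and> distinct (output_list n s) \<and>
     set (output_list n s) = {X \<in> flats {..<n} (faces {..<m} {..<n} M).
       \<exists>l\<in>D. elems n l \<in> faces {..<m} {..<n} M \<and> X = spanned {..<n} (faces {..<m} {..<n} M) (elems n l)}"

lemma output_list_cong:
  "var s' 3 = var s 3 \<Longrightarrow> s' 4 = s 4 \<Longrightarrow> output_list n s' = output_list n s"
  by (simp add: output_list_def)

lemma outputs_agree: "agree k s s' \<Longrightarrow> 8 \<le> k \<Longrightarrow> outputs n m M D s \<Longrightarrow> outputs n m M D s'"
  using inp_agree[of k s s' n m M] output_list_cong[of s' s n]
  by (simp add: outputs_def agree_def readable_def)

text \<open>The list has no repetitions and each member is spanned by a tuple of \<open>D\<close>.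
  This keeps the range of the novelty quantifier bounded throughout the run.\<close>

lemma outputs_length:
  assumes "outputs n m M D s" "D \<subseteq> tuples n k"
  shows "var s 3 \<le> Suc n ^ k"
proof -
  have "var s 3 = length (output_list n s)" by (simp add: output_list_def)
  also have "\<dots> = card (set (output_list n s))"
    using assms(1) unfolding outputs_def by (metis distinct_card)
  also have "\<dots> \<le> card ((\<lambda>l. spanned {..<n} (faces {..<m} {..<n} M) (elems n l)) ` tuples n k)"
    using assms by (intro card_mono finite_imageI finite_tuples) (auto simp: outputs_def)
  also have "\<dots> \<le> Suc n ^ k"
    using card_image_le[OF finite_tuples, of _ n k] by (simp add: card_tuples)
  finally show ?thesis .
qed

text \<open>Evaluating \<open>good_fm d\<close> dominates: writing a row takes only \<open>n\<close>
  evaluations of degree at most \<open>d\<close>. The hypothesis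
  \<open>D \<subseteq> tuples n (Suc d)\<close> bounds the length of the list.\<close>

lemma exec_step:
  assumes m: "m \<le> Suc n ^ d"
    and card: "\<And>I. I \<in> faces {..<m} {..<n} M \<Longrightarrow> card I \<le> Suc d"
    and Q: "outputs n m M D s" "D \<subseteq> tuples n (Suc d)"
    and tup: "map (var s) (base_vars d) \<in> tuples n (Suc d)"
  defines "C \<equiv> cost (good_fm d) + cost (span_fm (10 + d) (base_vars d) (9 + d)) + 10"
  shows "\<exists>t s'. exec (step_com d) s t s' \<and> t \<le> C * Suc n ^ (2 * d + 2) \<and>
    outputs n m M (insert (map (var s) (base_vars d)) D) s' \<and>
    (\<forall>x\<in>set (base_vars d). var s' x = var s x)"
proof -
  let ?H = "faces {..<m} {..<n} M" and ?xs = "base_vars d" and ?k = "9 + d"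
  let ?I = "elems n (map (var s) ?xs)" and ?N = "Suc n ^ (2 * d + 2)"
  define X where "X = spanned {..<n} ?H ?I"
  have inp: "inp n m M s" using Q by (simp add: outputs_def)
  have len: "var s 3 \<le> Suc n ^ Suc d" using Q by (rule outputs_length)
  have le: "var s ` set ?xs \<subseteq> {..n}" using tup by (auto simp: tuples_def)
  have lt: "\<forall>x\<in>set ?xs. x < ?k" "?k \<notin> set ?xs" by (auto simp: base_vars_def)
  have k: "8 \<le> ?k" by simp
  have good: "eval (good_fm d) s \<longleftrightarrow> ?I \<in> ?H \<and> X \<in> flats {..<n} ?H \<and> X \<notin> set (output_list n s)"
    using eval_ind[OF inp k lt(2) le] eval_flat[OF inp k lt(1) le card] eval_new[OF inp k lt(1) le]
    by (simp add: good_fm_def X_def)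
  have "\<exists>t s'. exec (compile (good_fm d)) s t s' \<and>
      t \<le> cost (good_fm d) * Suc n ^ degr (bound_exp d) (good_fm d) \<and>
      agree ?k s s' \<and> var s' 5 = of_bool (eval (good_fm d) s)"
    using var_bounds[OF inp m len] by (intro compile_correct wf_good) auto
  then obtain t1 s1 where 1: "exec (compile (good_fm d)) s t1 s1"
    "t1 \<le> cost (good_fm d) * Suc n ^ degr (bound_exp d) (good_fm d)" "agree ?k s s1"
    "var s1 5 = of_bool (eval (good_fm d) s)" by blast
  have t1: "t1 \<le> cost (good_fm d) * ?N"
  proof -
    have "Suc n ^ degr (bound_exp d) (good_fm d) \<le> ?N" by (intro power_increasing degr_good) auto
    then have "cost (good_fm d) * Suc n ^ degr (bound_exp d) (good_fm d) \<le> cost (good_fm d) * ?N"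
      by (rule mult_le_mono2)
    then show ?thesis using 1(2) by linarith
  qed
  define s2 where "s2 = upd s1 6 [] 1"
  have ag: "agree ?k s s2"
    unfolding s2_def by (intro agree_trans[OF 1(3)] agree_upd) (auto simp: readable_def)
  have vars: "var s2 x = var s x" if "readable ?k x" for x using ag that by (simp add: agree_def)
  have xs: "map (var s2) ?xs = map (var s) ?xs" using vars base_vars_readable by auto
  have Q2: "outputs n m M D s2" using outputs_agree[OF ag k Q(1)] .
  then have inp2: "inp n m M s2" by (simp add: outputs_def)
  have len2: "var s2 3 = var s 3" by (intro vars) (simp add: readable_def)
  show ?thesis
  proof (cases "eval (good_fm d) s")
    case False
    have "exec (Seq (Const 6 1) (If (Eq 5 6) (Seq (write_row d) (Inc 3)) Skip)) s1 3 s2"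
      using 1(4) False by (intro exec_test[where b = "eval (good_fm d) s" and t = 1])
        (auto simp: s2_def intro: exec.Skip[simplified])
    from exec.Seq[OF 1(1) this] have "exec (step_com d) s (t1 + 3) s2" by (simp add: step_com_def)
    moreover have "t1 + 3 \<le> C * ?N"
    proof -
      have "1 \<le> ?N" by (rule one_le_power) simp
      moreover have "C * ?N = cost (good_fm d) * ?N +
          cost (span_fm (10 + d) (base_vars d) (9 + d)) * ?N + 10 * ?N"
        unfolding C_def by (simp only: add_mult_distrib)
      ultimately show ?thesis using t1 by linarith
    qed
    \<comment> \<open>The tuple is not a face, spans no flat, or spans one already listed; in each
      case the set described by the invariant is the same with and without it.\<close>
    moreover have "outputs n m M (insert (map (var s) ?xs) D) s2"
    proof -
      have "set (output_list n s2) = set (output_list n s)" using Q2 Q by (simp add: outputs_def)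
      then have "\<not> (?I \<in> ?H \<and> X \<in> flats {..<n} ?H \<and> X \<notin> set (output_list n s2))"
        using good False by simp
      then show ?thesis using Q2 unfolding outputs_def X_def by blast
    qed
    ultimately show ?thesis using vars base_vars_readable by blast
  next
    case True
    define Cs where "Cs = cost (span_fm (10 + d) (base_vars d) (9 + d))"
    have "\<exists>t s'. exec (write_row d) s2 t s' \<and> t \<le> 2 + n * (Cs * Suc n ^ d + 5) \<and>
      (\<forall>x. readable (9 + d) x \<longrightarrow> var s' x = var s2 x) \<and> s' 2 = s2 2 \<and>
      s' 4 = (\<lambda>idx. if \<exists>j<n. idx = [var s2 3, j] then of_bool (idx ! 1 \<in> X) else s2 4 idx)"
      using exec_write_row[OF inp2 m, unfolded xs, folded X_def Cs_def] len len2 tup by simp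
    then obtain t3 s3 where 3: "exec (write_row d) s2 t3 s3" "t3 \<le> 2 + n * (Cs * Suc n ^ d + 5)"
      "\<And>x. readable ?k x \<Longrightarrow> var s3 x = var s2 x" "s3 2 = s2 2"
      "s3 4 = (\<lambda>idx. if \<exists>j<n. idx = [var s2 3, j] then of_bool (idx ! 1 \<in> X) else s2 4 idx)" by blast
    define s4 where "s4 = upd s3 3 [] (Suc (var s2 3))"
    have v3: "var s3 3 = var s2 3" by (intro 3(3)) (simp add: readable_def)
    have "exec (Inc 3) s3 1 s4" using v3 by (intro exec_IncI) (simp_all add: s4_def)
    with 3(1) have "exec (Seq (write_row d) (Inc 3)) s2 (t3 + 1) s4" by (rule exec.Seq)
    then have "exec (Seq (Const 6 1) (If (Eq 5 6) (Seq (write_row d) (Inc 3)) Skip)) s1 (t3 + 3) s4"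
      using 1(4) True
      by (intro exec_test[where b = "eval (good_fm d) s" and t = "t3 + 1"]) (auto simp: s2_def)
    from exec.Seq[OF 1(1) this] have "exec (step_com d) s (t1 + (t3 + 3)) s4"
      by (simp add: step_com_def)
    moreover have "t1 + (t3 + 3) \<le> C * ?N"
    proof -
      have N: "?N = Suc n ^ d * (Suc n * Suc n ^ Suc d)"
        unfolding power_Suc[symmetric] power_add[symmetric]
        by (rule arg_cong[where f = "power (Suc n)"]) simp
      have "n \<le> Suc n * 1" by simp
      also have "\<dots> \<le> Suc n * Suc n ^ Suc d" by (intro mult_le_mono2 one_le_power) simp
      finally have "n * Suc n ^ d \<le> Suc n * Suc n ^ Suc d * Suc n ^ d" by (rule mult_le_mono1)
      then have a: "n * Suc n ^ d \<le> ?N" unfolding N by (simp only: mult.commute)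
      have "n \<le> n * Suc n ^ d" by simp
      then have b: "n \<le> ?N" using a by linarith
      have "n * (Cs * Suc n ^ d + 5) = Cs * (n * Suc n ^ d) + 5 * n" by (simp add: algebra_simps)
      also have "\<dots> \<le> Cs * ?N + 5 * ?N" using a b by (intro add_mono mult_le_mono2)
      finally have "t3 \<le> 2 + (Cs * ?N + 5 * ?N)" using 3(2) by linarith
      moreover have "1 \<le> ?N" by (rule one_le_power) simp
      moreover have "C * ?N = cost (good_fm d) * ?N + Cs * ?N + 10 * ?N"
        unfolding C_def Cs_def by (simp only: add_mult_distrib)
      ultimately show ?thesis using t1 by linarith
    qed
    moreover have "outputs n m M (insert (map (var s) ?xs) D) s4"
    proof -
      have sX: "X \<subseteq> {..<n}" by (auto simp: X_def spanned_def)
      have "inp n m M s4" using inp2 3(3)[of 0] 3(3)[of 1] 3(3)[of 7] 3(4)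
        by (simp add: inp_def s4_def upd_def readable_def)
      \<comment> \<open>The new row lies just beyond the old list, so earlier members are unchanged
        and the increment of variable \<open>3\<close> appends \<open>X\<close>.\<close>
      moreover have "output_list n s4 = output_list n s2 @ [X]"
      proof -
        have "{j. j < n \<and> s4 4 [i, j] = 1} = {j. j < n \<and> s2 4 [i, j] = 1}" if "i < var s2 3" for i
          using that by (auto simp: s4_def upd_def 3(5))
        moreover have "{j. j < n \<and> s4 4 [var s2 3, j] = 1} = X"
          using sX by (auto simp: s4_def upd_def 3(5) split: if_splits)
        moreover have "var s4 3 = Suc (var s2 3)" by (simp add: s4_def upd_def)
        ultimately show ?thesis by (simp add: output_list_def)
      qed
      moreover have "output_list n s2 = output_list n s"
        using ag by (intro output_list_cong) (auto simp: agree_def readable_def)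
      ultimately show ?thesis using Q True good unfolding outputs_def X_def by auto
    qed
    moreover have "\<forall>x\<in>set ?xs. var s4 x = var s x"
    proof
      fix x assume "x \<in> set ?xs"
      then have "readable ?k x" "x \<noteq> 3" by (auto simp: base_vars_def readable_def)
      then show "var s4 x = var s x" using 3(3) vars by (simp add: s4_def upd_def)
    qed
    ultimately show ?thesis by blast
  qed
qed

section \<open>Completeness of the list and total running time\<close>

theorem theorem7p4:
  fixes d :: nat
  assumes "d \<ge> 2"
  shows "\<exists>P :: com. \<exists>T :: nat \<Rightarrow> real.
    T \<in> O(\<lambda>n. real n ^ (3 * d + 3)) \<and>
    (\<forall>(n :: nat) (m :: nat) (M :: nat \<Rightarrow> nat \<Rightarrow> bool).
       reduced {..<m} {..<n} M \<and>
       simplicial_complex {..<n} (faces {..<m} {..<n} M) \<and>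
       dimension (faces {..<m} {..<n} M) = int d \<longrightarrow>
       (\<exists>t s. exec P (input_store n m M) t s \<and> real t \<le> T n \<and>
          distinct (output_list n s) \<and>
          set (output_list n s) = flats {..<n} (faces {..<m} {..<n} M)))"
proof -
  define C where "C = cost (good_fm d) + cost (span_fm (10 + d) (base_vars d) (9 + d)) + 10"
  \<comment> \<open>\<open>C\<close> accounts for one round, \<open>4 * Suc d\<close> for the
    \<open>d + 1\<close> nested loops, and \<open>2\<close> for setting variable
    \<open>7\<close>.\<close>
  define K where "K = C + 4 * Suc d + 2"
  let ?xs = "base_vars d"
  have len: "length ?xs = Suc d" by (simp add: base_vars_def)
  have run: "\<exists>t s. exec (flats_com d) (input_store n m M) t s \<and> t \<le> K * Suc n ^ (3 * d + 3) \<and>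
      distinct (output_list n s) \<and> set (output_list n s) = flats {..<n} (faces {..<m} {..<n} M)"
    if red: "reduced {..<m} {..<n} M" and sc: "simplicial_complex {..<n} (faces {..<m} {..<n} M)"
      and dim: "dimension (faces {..<m} {..<n} M) = int d" for n m M
  proof -
    let ?H = "faces {..<m} {..<n} M"
    define s0 where "s0 = upd (upd (input_store n m M) 7 [] n) 7 [] (Suc n)"
    define Q where "Q D s \<longleftrightarrow> D \<subseteq> tuples n (Suc d) \<and> outputs n m M D s" for D s
    have m: "m \<le> Suc n ^ d" using card_rows_le[OF red sc dim] .
    have card: "card I \<le> Suc d" if "I \<in> ?H" for I using card_face_le[OF sc dim that] .
    have Q0: "Q {} s0"
      by (auto simp: Q_def outputs_def inp_def output_list_def s0_def upd_def input_store_def)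
    have "\<exists>t s. exec (nest ?xs (step_com d)) s0 t s \<and>
      t \<le> (C * Suc n ^ (2 * d + 2) + 4 * length ?xs) * Suc n ^ length ?xs \<and>
      Q ({} \<union> {map (var s0) [] @ l | l. l \<in> tuples n (length ?xs)}) s \<and>
      (\<forall>x\<in>set []. var s x = var s0 x)"
    proof (rule exec_nest)
      fix D s assume Q: "Q D s" and tup: "map (var s) ?xs \<in> tuples n (length ?xs)"
      show "\<exists>t s'. exec (step_com d) s t s' \<and> t \<le> C * Suc n ^ (2 * d + 2) \<and>
          Q (insert (map (var s) ?xs) D) s' \<and> (\<forall>x\<in>set ?xs. var s' x = var s x)"
        using exec_step[where D = D and s = s, OF m card] Q tup unfolding Q_def C_def len by blast
    next
      fix D s v i assume "Q D s" "v \<in> set ?xs"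
      moreover from this have "agree 8 s (upd s v [] i)"
        by (intro agree_upd) (auto simp: base_vars_def readable_def)
      ultimately show "Q D (upd s v [] i)" using outputs_agree by (simp add: Q_def)
    next
      show "distinct ?xs" "7 \<notin> set ?xs" by (simp_all add: base_vars_def)
    qed (use Q0 in \<open>auto simp: Q_def outputs_def inp_def\<close>)
    then obtain t s where t: "exec (nest ?xs (step_com d)) s0 t s"
      "t \<le> (C * Suc n ^ (2 * d + 2) + 4 * Suc d) * Suc n ^ Suc d" "Q (tuples n (Suc d)) s"
      by (auto simp: len)
    have "exec (flats_com d) (input_store n m M) (1 + (1 + t)) s"
      unfolding flats_com_def
    proof (intro exec.Seq)
      show "exec (Load 7 0 []) (input_store n m M) 1 (upd (input_store n m M) 7 [] n)"
        by (intro exec_LoadI) (simp_all add: input_store_def)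
      show "exec (Inc 7) (upd (input_store n m M) 7 [] n) 1 s0"
        by (intro exec_IncI) (simp_all add: s0_def upd_def)
    qed (fact t(1))
    moreover have "1 + (1 + t) \<le> K * Suc n ^ (3 * d + 3)"
    proof -
      let ?P = "Suc n ^ (3 * d + 3)"
      \<comment> \<open>The exponent \<open>2 * d + 2\<close> of one round and \<open>d + 1\<close>
        for the number of tuples add up to \<open>3 * d + 3\<close>.\<close>
      have P: "Suc n ^ (2 * d + 2) * Suc n ^ Suc d = ?P"
        unfolding power_add[symmetric] by (rule arg_cong[where f = "power (Suc n)"]) simp
      have "Suc n ^ Suc d \<le> ?P" by (intro power_increasing) auto
      then have "4 * Suc d * Suc n ^ Suc d \<le> 4 * Suc d * ?P" by (rule mult_le_mono2)
      moreover have "(C * Suc n ^ (2 * d + 2) + 4 * Suc d) * Suc n ^ Suc d =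
          C * ?P + 4 * Suc d * Suc n ^ Suc d"
        unfolding P[symmetric] by (simp only: add_mult_distrib mult.assoc)
      moreover have "K * ?P = C * ?P + 4 * Suc d * ?P + 2 * ?P"
        unfolding K_def by (simp only: add_mult_distrib)
      moreover have "1 \<le> ?P" by (rule one_le_power) simp
      ultimately show ?thesis using t(2) by linarith
    qed
    moreover have "set (output_list n s) = flats {..<n} ?H"
    proof -
      \<comment> \<open>Every flat is spanned by a face, and every face is coded by some tuple. With
        all tuples processed, the invariant therefore lists all flats.\<close>
      have "\<exists>l\<in>tuples n (Suc d). elems n l \<in> ?H \<and> X = spanned {..<n} ?H (elems n l)"
        if X: "X \<in> flats {..<n} ?H" for X
      proof -
        obtain I where I: "I \<in> ?H" "X = spanned {..<n} ?H I" using flat_spanned[OF sc X] by blast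
        then obtain l where "l \<in> tuples n (Suc d)" "elems n l = I"
          using ex_tuple[of I n "Suc d"] card[OF I(1)] by (auto simp: faces_iff_chain)
        then show ?thesis using I by blast
      qed
      then show ?thesis using t(3) unfolding Q_def outputs_def by blast
    qed
    moreover have "distinct (output_list n s)" using t(3) by (simp add: Q_def outputs_def)
    ultimately show ?thesis by blast
  qed
  define T where "T n = real (K * Suc n ^ (3 * d + 3))" for n
  have "T \<in> O(\<lambda>n. real n ^ (3 * d + 3))"
  proof (rule bigoI)
    \<comment> \<open>The factor \<open>2 ^ (3 * d + 3)\<close> comes from
      \<open>Suc n \<le> 2 * n\<close>, valid for \<open>n \<ge> 1\<close>.\<close>
    show "\<forall>\<^sub>F n in sequentially. norm (T n) \<le> (real K * 2 ^ (3 * d + 3)) * norm (real n ^ (3 * d + 3))"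
      using eventually_ge_at_top[of 1]
    proof eventually_elim
      case (elim n)
      have "Suc n ^ (3 * d + 3) \<le> (2 * n) ^ (3 * d + 3)" using elim by (intro power_mono) auto
      then have "K * Suc n ^ (3 * d + 3) \<le> K * (2 * n) ^ (3 * d + 3)" by (rule mult_le_mono2)
      then have "real (K * Suc n ^ (3 * d + 3)) \<le> real (K * (2 * n) ^ (3 * d + 3))"
        by (simp only: of_nat_le_iff)
      then show ?case by (simp only: T_def) (simp add: power_mult_distrib)
    qed
  qed
  moreover have "\<exists>t s. exec (flats_com d) (input_store n m M) t s \<and> real t \<le> T n \<and>
      distinct (output_list n s) \<and> set (output_list n s) = flats {..<n} (faces {..<m} {..<n} M)"
    if "reduced {..<m} {..<n} M" "simplicial_complex {..<n} (faces {..<m} {..<n} M)"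
      "dimension (faces {..<m} {..<n} M) = int d" for n m M
    using run[OF that] unfolding T_def by (metis of_nat_le_iff)
  ultimately show ?thesis by blast
qed

end
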